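(* Suppose that $\phi^0\in C^0(\bar\Omega;\mathbb{R})$ satisfies $\phi^0|_{\partial\Omega}=0$, $\phi^0>0$ on $\Omega^+(0)$, $\phi^0<0$ on $\Omega^-(0)$, $\{x\in\Omega\mid\phi^0(x)=0\}=\Sigma(0)$, $\nabla\phi^0\neq0$ on $\Sigma(0)$, and that $\phi^0$ is $C^2$-smooth in a neighborhood of $\Sigma(0)$. Let $\varepsilon_0>0$ be such that $\Sigma_{\varepsilon_0}(0)\subset\Omega$, $\phi^0$ is $C^2$-smooth on $\Sigma_{\varepsilon_0}(0)$ and $\inf_{\xi\in\Sigma_{\varepsilon_0}(0)}|\nabla\phi^0(\xi)|>0$, and suppose that the constant $r_\ast$ in the definition of $\eta$ satisfies $$r_\ast\in(0,1),\qquad\sqrt{r_\ast}\le\frac12\inf_{\xi\in\Sigma_{\varepsilon_0}(0)}|\nabla\phi^0(\xi)|.$$ Let $\Theta$ be a ($t$-global) tubular neighborhood of $\{\Sigma(t)\}_{t\ge0}$ with $\Theta|_{t=0}\subset\{0\}\times\Sigma_{\varepsilon_0}(0)$, and $\phi:\Theta\to\mathbb{R}$ a $C^2$-function solving $$\frac{\partial\phi}{\partial t}(t,x)+v\Big(t,\,x-\frac{\phi(t,x)\nabla\phi(t,x)}{|\nabla\phi(t,x)|^2}\Big)\cdot\nabla\phi(t,x)=0\ \text{ in }\Theta|_{t>0},\qquad\phi=\phi^0\ \text{ on }\Theta|_{t=0},$$ such that $\phi(t,\cdot)>0$ in $\Theta\cap\Omega^+(t)$ and $\phi(t,\cdot)<0$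 in $\Theta\cap\Omega^-(t)$ for each $t\ge0$, and such that for every $(t,x)\in\Theta$ there exists $\xi$ with $(0,\xi)\in\Theta$ and $|\nabla\phi(t,x)|=|\nabla\phi^0(\xi)|\neq0$. Let $\tilde\phi\in C^0([0,\infty)\times\bar\Omega;\mathbb{R})$ be the unique viscosity solution of $$\begin{cases}\dfrac{\partial\tilde\phi}{\partial t}(t,x)+v\Big(t,\,x-\dfrac{\tilde\phi(t,x)\nabla\tilde\phi(t,x)}{|\nabla\tilde\phi(t,x)|^2+\eta(|\nabla\tilde\phi(t,x)|^2)}\Big)\cdot\nabla\tilde\phi(t,x)=0&\text{in }(0,\infty)\times\Omega,\\ \tilde\phi(0,x)=\phi^0(x)&\text{on }\Omega,\\ \tilde\phi(t,x)=0&\text{on }[0,\infty)\times\partial\Omega,\end{cases}$$ which satisfies $\tilde\phi(t,\cdot)>0$ in $\Omega^+(t)$, $\tilde\phi(t,\cdot)<0$ in $\Omega^-(t)$, $\tilde\phi(t,\cdot)=0$ on $\Sigma(t)$ for all $t\ge0$. Then there exists a ($t$-global) tubular neighborhood $\tilde\Theta\subset\Theta$ of $\{\Sigma(t)\}_{t\ge0}$ in which $\phi\equiv\tilde\phi$ holds.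
   Context: Setting. $\Omega\subset\mathbb{R}^3$ is a bounded connected open set and $v=v(t,x):[0,\infty)\times\bar\Omega\to\mathbb{R}^3$ is a given function satisfying: (H1) $v\in C^0([0,\infty)\times\bar\Omega;\mathbb{R}^3)\cap C^1([0,\infty)\times\Omega;\mathbb{R}^3)$; $v$ is Lipschitz continuous in $x$ on $[0,\infty)\times\bar\Omega$; $v$ is twice partially differentiable in $x$; all of these partial derivatives of $v$ belong to $C^0([0,\infty)\times\Omega;\mathbb{R}^3)$. (H2) $\pm v(s,x)\in T_{\partial\Omega}(x)$ for all $(s,x)\in[0,\infty)\times\partial\Omega$, where $T_{\partial\Omega}(x):=\{z\in\mathbb{R}^3\mid\liminf_{h\to0+}\mathrm{dist}(x+hz,\partial\Omega)/h=0\}$. No regularity of $\partial\Omega$ is assumed. $X(s,\tau,\xi)$ denotes the flow of $x'(s)=v(s,x(s))$ on $\bar\Omega$, i.e. $s\mapsto X(s,\tau,\xi)$ is the unique solution with $x(\tau)=\xi$; by (H1), (H2), $\Omega$ and $\partial\Omega$ are forward and backward flow invariant for times in $[0,\infty)$. $\Omega^+(0)\subset\Omega$ is a subdomain such that $\Sigma(0):=\partial\Omega^+(0)$ is a closed $C^2$-smooth surface with $\Sigma(0)\cap\partial\Omega=\emptyset$, and $\Omega^-(0):=\Omega\setminus(\Omega^+(0)\cup\Sigma(0))$. For $t\ge0$, $\Omega^\pm(t):=X(t,0,\Omega^\pm(0))$ and $\Sigma(t):=X(t,0,\Sigma(0))$. For $\varepsilon>0$, $\Sigma_\varepsilon(t):=\bigcup_{x\in\Sigma(t)}\{y\in\mathbb{R}^3\mid|x-y|<\varepsilon\}$.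 A set $\Theta\subset[0,\infty)\times\Omega$ is a ($t$-global) tubular neighborhood of $\{\Sigma(t)\}_{t\ge0}$ if $\Theta\supset\bigcup_{t\ge0}(\{t\}\times\Sigma(t))$, the set $\{x\in\Omega\mid(t,x)\in\Theta\}$ is open for each $t\ge0$, and there is a nonincreasing function $\varepsilon:[0,\infty)\to\mathbb{R}_{>0}$ with $\{t\}\times\Sigma_{\varepsilon(t)}(t)\subset\Theta$ for all $t\ge0$. $\Theta|_{t>0}$ and $\Theta|_{t=0}$ denote the parts of $\Theta$ with $t>0$ and $t=0$; "in $\Theta\cap\Omega^\pm(t)$" refers to points $x\in\Omega^\pm(t)$ with $(t,x)\in\Theta$. $\nabla$ is the gradient in $x$. In the PDE for the $C^2$-function on $\Theta$, the spatial argument of $v$ is understood to lie in $\bar\Omega$, where the original $v$ is defined. Extension of $v$ (used in the viscosity problem): $v$ is extended to a function on $[0,\infty)\times\mathbb{R}^3$, still denoted by $v$, which is continuous in $(t,x)$ and Lipschitz continuous in $x$ (uniformly in $t$). If $\lambda$ is a Lipschitz constant in $x$ of the components $v_i$, such an extension is given by $v_i(t,x):=\inf_{z\in\bar\Omega}\{v_i(t,z)+\lambda|x-z|\}$, $i=1,2,3$. Cut-off: $\eta:[0,\infty)\to[0,1]$ is a $C^1$-function with $\eta(0)=1$, $\eta(r)=0$ for $r\ge r_\ast$, where $r_\ast\in(0,1)$ is a fixed constant, and $\eta$ monotone decreasing in between. Viscosity solutions: Let $O\subset\mathbb{R}^N$ be open and $\mathcal{H}:O\times\mathbb{R}\times\mathbb{R}^N\to\mathbb{R}$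 continuous. For a locally bounded $u:O\to\mathbb{R}$ let $u^\ast$, $u_\ast$ be its upper/lower semicontinuous envelopes. $u$ is a viscosity subsolution (resp. supersolution) of $\mathcal{H}(z,u(z),\nabla_zu(z))=0$ in $O$ if $u^\ast$ is bounded from above (resp. $u_\ast$ is bounded from below) and, whenever $(\varphi,z)\in C^1(O;\mathbb{R})\times O$ is such that $u^\ast-\varphi$ has a local maximum (resp. $u_\ast-\varphi$ has a local minimum) at $z$, one has $\mathcal{H}(z,u^\ast(z),\nabla\varphi(z))\le0$ (resp. $\mathcal{H}(z,u_\ast(z),\nabla\varphi(z))\ge0$). A viscosity solution is a function that is both. Here this is applied with $z=(t,x)$ and $O=(0,\infty)\times\Omega$; initial and boundary conditions are in the classical sense. The existence and uniqueness of $\tilde\phi$, with the stated sign properties, hold under the stated hypotheses. *)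

theory Defs
  imports "HOL-Analysis.Analysis"
begin

section \<open>Regularity\<close>

(* Derivatives are taken within S.  On an open S this is the usual notion; on sets such as
   [0,\<infinity>) x Omega it means one-sided differentiability in time at t = 0, with derivatives
   that are continuous up to t = 0. *)

definition C1_on :: "'a::real_normed_vector set \<Rightarrow> ('a \<Rightarrow> 'b::real_normed_vector) \<Rightarrow> bool" where
  "C1_on S f \<longleftrightarrow>
     (\<exists>D :: 'a \<Rightarrow> 'a \<Rightarrow>\<^sub>L 'b. continuous_on S D \<and>
        (\<forall>z\<in>S. (f has_derivative blinfun_apply (D z)) (at z within S)))"

definition C2_on :: "'a::real_normed_vector set \<Rightarrow> ('a \<Rightarrow> 'b::real_normed_vector) \<Rightarrow> bool" where
  "C2_on S f \<longleftrightarrow>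
     (\<exists>D :: 'a \<Rightarrow> 'a \<Rightarrow>\<^sub>L 'b. C1_on S D \<and>
        (\<forall>z\<in>S. (f has_derivative blinfun_apply (D z)) (at z within S)))"

(* An arbitrary value where f is not differentiable. *)
definition grad :: "('a::real_inner \<Rightarrow> real) \<Rightarrow> 'a \<Rightarrow> 'a" where
  "grad f x = (THE g. GDERIV f x :> g)"

(* A closed surface is compact and without boundary; it need not be connected.
   The C2-smooth embedded surface is described by local regular C2 equations. *)
definition closed_C2_surface :: "(real^3) set \<Rightarrow> bool" where
  "closed_C2_surface S \<longleftrightarrow> compact S \<and>
     (\<forall>p\<in>S. \<exists>U F. open U \<and> p \<in> U \<and> C2_on U F \<and> (\<forall>x\<in>U. grad F x \<noteq> 0) \<and>
        S \<inter> U = {x\<in>U. F x = (0::real)})"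


section \<open>The velocity field and its flow\<close>

definition tangent_cone :: "'a::real_normed_vector set \<Rightarrow> 'a \<Rightarrow> 'a set" where
  "tangent_cone K x =
     {z. Liminf (at_right (0::real)) (\<lambda>h. ereal (infdist (x + h *\<^sub>R z) K / h)) = 0}"

definition partial_deriv_at ::
    "(real^3 \<Rightarrow> 'b::real_normed_vector) \<Rightarrow> 3 \<Rightarrow> real^3 \<Rightarrow> 'b \<Rightarrow> bool" where
  "partial_deriv_at f i x d \<longleftrightarrow> ((\<lambda>h. f (x + h *\<^sub>R axis i 1)) has_vector_derivative d) (at 0)"

definition hyp_H1 :: "(real^3) set \<Rightarrow> (real \<Rightarrow> real^3 \<Rightarrow> real^3) \<Rightarrow> bool" where
  "hyp_H1 \<Omega> v \<longleftrightarrow>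
     continuous_on ({0..} \<times> closure \<Omega>) (\<lambda>(t, x). v t x) \<and>
     C1_on ({0..} \<times> \<Omega>) (\<lambda>(t, x). v t x) \<and>
     (\<exists>L. \<forall>t\<ge>0. L-lipschitz_on (closure \<Omega>) (v t)) \<and>
     (\<exists>(D :: 3 \<Rightarrow> real \<Rightarrow> real^3 \<Rightarrow> real^3) (DD :: 3 \<Rightarrow> 3 \<Rightarrow> real \<Rightarrow> real^3 \<Rightarrow> real^3).
        (\<forall>i. \<forall>t\<ge>0. \<forall>x\<in>\<Omega>. partial_deriv_at (v t) i x (D i t x)) \<and>
        (\<forall>i j. \<forall>t\<ge>0. \<forall>x\<in>\<Omega>. partial_deriv_at (D i t) j x (DD i j t x)) \<and>
        (\<forall>i. continuous_on ({0..} \<times> \<Omega>) (\<lambda>(t, x). D i t x)) \<and>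
        (\<forall>i j. continuous_on ({0..} \<times> \<Omega>) (\<lambda>(t, x). DD i j t x)))"

definition hyp_H2 :: "(real^3) set \<Rightarrow> (real \<Rightarrow> real^3 \<Rightarrow> real^3) \<Rightarrow> bool" where
  "hyp_H2 \<Omega> v \<longleftrightarrow>
     (\<forall>s\<ge>0. \<forall>x\<in>frontier \<Omega>. v s x \<in> tangent_cone (frontier \<Omega>) x \<and>
                          - v s x \<in> tangent_cone (frontier \<Omega>) x)"

(* X s tau xi is the state at time s of the solution passing through xi at time tau.
   Uniqueness of that solution follows from the Lipschitz condition in hyp_H1. *)
definition is_flow ::
    "(real^3) set \<Rightarrow> (real \<Rightarrow> real^3 \<Rightarrow> real^3) \<Rightarrow> (real \<Rightarrow> real \<Rightarrow> real^3 \<Rightarrow> real^3) \<Rightarrow> bool" where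
  "is_flow \<Omega> v X \<longleftrightarrow>
     (\<forall>\<tau>\<ge>0. \<forall>\<xi>\<in>closure \<Omega>. X \<tau> \<tau> \<xi> = \<xi> \<and>
        (\<forall>s\<ge>0. X s \<tau> \<xi> \<in> closure \<Omega> \<and>
           ((\<lambda>r. X r \<tau> \<xi>) has_vector_derivative v s (X s \<tau> \<xi>)) (at s within {0..})))"

definition is_extension ::
    "(real^3) set \<Rightarrow> (real \<Rightarrow> real^3 \<Rightarrow> real^3) \<Rightarrow> (real \<Rightarrow> real^3 \<Rightarrow> real^3) \<Rightarrow> bool" where
  "is_extension \<Omega> v w \<longleftrightarrow>
     (\<forall>t\<ge>0. \<forall>x\<in>closure \<Omega>. w t x = v t x) \<and>
     continuous_on ({0..} \<times> UNIV) (\<lambda>(t, x). w t x) \<and>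
     (\<exists>L. \<forall>t\<ge>0. L-lipschitz_on UNIV (w t))"


section \<open>Tubular neighborhoods\<close>

definition eps_nbhd :: "'a::metric_space set \<Rightarrow> real \<Rightarrow> 'a set" where
  "eps_nbhd S \<epsilon> = (\<Union>x\<in>S. ball x \<epsilon>)"

definition tubular_nbhd ::
    "(real^3) set \<Rightarrow> (real \<Rightarrow> (real^3) set) \<Rightarrow> (real \<times> (real^3)) set \<Rightarrow> bool" where
  "tubular_nbhd \<Omega> \<Sigma> \<Theta> \<longleftrightarrow>
     \<Theta> \<subseteq> {0..} \<times> \<Omega> \<and>
     (\<Union>t\<in>{0..}. {t} \<times> \<Sigma> t) \<subseteq> \<Theta> \<and>
     (\<forall>t\<ge>0. open {x\<in>\<Omega>. (t, x) \<in> \<Theta>}) \<and>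
     (\<exists>\<epsilon> :: real \<Rightarrow> real. (\<forall>t\<ge>0. \<epsilon> t > 0) \<and> antimono_on {0..} \<epsilon> \<and>
        (\<forall>t\<ge>0. {t} \<times> eps_nbhd (\<Sigma> t) (\<epsilon> t) \<subseteq> \<Theta>))"


section \<open>The classical problem\<close>

(* The time derivative is taken along the section of Theta through x, because only the
   sections of Theta at fixed t are required to be open.  The equation includes that the
   spatial argument of v stays in the closure of Omega, where v is given. *)
definition solves_on_tube ::
    "(real^3) set \<Rightarrow> (real \<Rightarrow> real^3 \<Rightarrow> real^3) \<Rightarrow> (real \<times> (real^3)) set \<Rightarrow>
     (real \<times> (real^3) \<Rightarrow> real) \<Rightarrow> bool" where
  "solves_on_tube \<Omega> v \<Theta> \<phi> \<longleftrightarrow>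
     (\<forall>(t, x)\<in>\<Theta>. t > 0 \<longrightarrow>
        (let p = grad (\<lambda>y. \<phi> (t, y)) x;
             y = x - (\<phi> (t, x) / (norm p)\<^sup>2) *\<^sub>R p
         in y \<in> closure \<Omega> \<and>
            (\<exists>q. ((\<lambda>s. \<phi> (s, x)) has_real_derivative q) (at t within {s. (s, x) \<in> \<Theta>}) \<and>
                 q + v t y \<bullet> p = 0)))"


section \<open>Viscosity solutions\<close>

definition locally_bounded_on :: "'a::metric_space set \<Rightarrow> ('a \<Rightarrow> real) \<Rightarrow> bool" where
  "locally_bounded_on U u \<longleftrightarrow> (\<forall>z\<in>U. \<exists>r>0. bounded (u ` (U \<inter> ball z r)))"

(* For locally bounded u the extended real values are finite. *)
definition usc_envelope :: "'a::metric_space set \<Rightarrow> ('a \<Rightarrow> real) \<Rightarrow> 'a \<Rightarrow> real" where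
  "usc_envelope U u z = real_of_ereal (INF r\<in>{0<..}. SUP y\<in>U \<inter> ball z r. ereal (u y))"

definition lsc_envelope :: "'a::metric_space set \<Rightarrow> ('a \<Rightarrow> real) \<Rightarrow> 'a \<Rightarrow> real" where
  "lsc_envelope U u z = real_of_ereal (SUP r\<in>{0<..}. INF y\<in>U \<inter> ball z r. ereal (u y))"

definition local_max_at :: "'a::metric_space set \<Rightarrow> ('a \<Rightarrow> real) \<Rightarrow> 'a \<Rightarrow> bool" where
  "local_max_at U f z \<longleftrightarrow> (\<exists>r>0. \<forall>y\<in>U \<inter> ball z r. f y \<le> f z)"

definition local_min_at :: "'a::metric_space set \<Rightarrow> ('a \<Rightarrow> real) \<Rightarrow> 'a \<Rightarrow> bool" where
  "local_min_at U f z \<longleftrightarrow> (\<exists>r>0. \<forall>y\<in>U \<inter> ball z r. f z \<le> f y)"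

definition viscosity_subsolution ::
    "'a::euclidean_space set \<Rightarrow> ('a \<Rightarrow> real \<Rightarrow> 'a \<Rightarrow> real) \<Rightarrow> ('a \<Rightarrow> real) \<Rightarrow> bool" where
  "viscosity_subsolution U H u \<longleftrightarrow>
     locally_bounded_on U u \<and> bdd_above (usc_envelope U u ` U) \<and>
     (\<forall>\<phi>. \<forall>z\<in>U. C1_on U \<phi> \<and> local_max_at U (\<lambda>y. usc_envelope U u y - \<phi> y) z \<longrightarrow>
        H z (usc_envelope U u z) (grad \<phi> z) \<le> 0)"

definition viscosity_supersolution ::
    "'a::euclidean_space set \<Rightarrow> ('a \<Rightarrow> real \<Rightarrow> 'a \<Rightarrow> real) \<Rightarrow> ('a \<Rightarrow> real) \<Rightarrow> bool" where
  "viscosity_supersolution U H u \<longleftrightarrow>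
     locally_bounded_on U u \<and> bdd_below (lsc_envelope U u ` U) \<and>
     (\<forall>\<phi>. \<forall>z\<in>U. C1_on U \<phi> \<and> local_min_at U (\<lambda>y. lsc_envelope U u y - \<phi> y) z \<longrightarrow>
        H z (lsc_envelope U u z) (grad \<phi> z) \<ge> 0)"

definition viscosity_solution ::
    "'a::euclidean_space set \<Rightarrow> ('a \<Rightarrow> real \<Rightarrow> 'a \<Rightarrow> real) \<Rightarrow> ('a \<Rightarrow> real) \<Rightarrow> bool" where
  "viscosity_solution U H u \<longleftrightarrow> viscosity_subsolution U H u \<and> viscosity_supersolution U H u"

definition cutoff :: "real \<Rightarrow> (real \<Rightarrow> real) \<Rightarrow> bool" where
  "cutoff r\<^sub>0 \<eta> \<longleftrightarrow>
     C1_on {0..} \<eta> \<and> \<eta> ` {0..} \<subseteq> {0..1} \<and> \<eta> 0 = 1 \<and> (\<forall>r\<ge>r\<^sub>0. \<eta> r = 0) \<and>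
     antimono_on {0..r\<^sub>0} \<eta>"

(* With z = (t, x), the gradient variable p consists of the time derivative fst p and
   the spatial gradient snd p; w is the extended velocity field. *)
definition hamiltonian ::
    "(real \<Rightarrow> real^3 \<Rightarrow> real^3) \<Rightarrow> (real \<Rightarrow> real) \<Rightarrow>
     real \<times> (real^3) \<Rightarrow> real \<Rightarrow> real \<times> (real^3) \<Rightarrow> real" where
  "hamiltonian w \<eta> z u p =
     fst p +
     w (fst z) (snd z - (u / ((norm (snd p))\<^sup>2 + \<eta> ((norm (snd p))\<^sup>2))) *\<^sub>R snd p) \<bullet> snd p"

definition solves_viscosity_problem ::
    "(real^3) set \<Rightarrow> (real \<Rightarrow> real^3 \<Rightarrow> real^3) \<Rightarrow> (real \<Rightarrow> real) \<Rightarrow> (real^3 \<Rightarrow> real) \<Rightarrow>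
     (real \<times> (real^3) \<Rightarrow> real) \<Rightarrow> bool" where
  "solves_viscosity_problem \<Omega> w \<eta> \<phi>\<^sub>0 \<psi> \<longleftrightarrow>
     continuous_on ({0..} \<times> closure \<Omega>) \<psi> \<and>
     viscosity_solution ({0<..} \<times> \<Omega>) (hamiltonian w \<eta>) \<psi> \<and>
     (\<forall>x\<in>\<Omega>. \<psi> (0, x) = \<phi>\<^sub>0 x) \<and>
     (\<forall>t\<ge>0. \<forall>x\<in>frontier \<Omega>. \<psi> (t, x) = 0)"

end

theory Submission
  imports Defs
begin

text \<open>
  Near the moving surface both functions solve the regularized equation, because the cut-off vanishes
  at gradients of norm at least half of the infimum in the hypothesis. The Hamiltonian is Lipschitz
  in the value of the unknown, and on the surface it propagates information with the flow velocity;
  at distance d from the surface the speed relative to the flow is of order d. Hence the region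
  where \<open>\<bar>\<phi>\<bar> exp (K t)\<close> is small is a domain of dependence for all times. This is made quantitative
  by the barriers \<open>\<phi> \<plusminus> h(\<phi> exp (K t))\<close>, where h vanishes on a smaller region and exceeds the
  oscillation of the difference at the rim, so that no boundary data are needed. The sign conditions
  enter only to show that \<open>\<phi>\<close> vanishes exactly on the surface.
\<close>

subsection \<open>Gradients and semicontinuous envelopes\<close>

text \<open>A barrier built on the differentiable function \<open>\<phi>\<close> is itself a test
  function, so one touching point suffices and no doubling of variables is needed. The obstacle is
  the side where \<open>\<phi>\<close> is negative: adding a term that grows with the modulus of
  \<open>\<phi>\<close> flattens the gradient there and may even reverse it, so that the cut-off can
  become active although it is inactive for \<open>\<phi>\<close>. This happens only where the added
  term is steep relative to \<open>\<phi>\<close>, and there the factor exp (K t) produces a time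
  derivative large enough to pay for it. Since the argument needs a compact tube, it runs on bounded
  time intervals, each with its own radius, and these radii must finally be merged into one
  nonincreasing function.\<close>

lemma grad_eqI: "GDERIV f x :> g \<Longrightarrow> grad f x = g"
  unfolding grad_def
proof (rule the_equality)
  fix h assume "GDERIV f x :> g" "GDERIV f x :> h"
  then have "(\<lambda>k. k \<bullet> h) = (\<lambda>k. k \<bullet> g)"
    unfolding gderiv_def by (rule has_derivative_unique[rotated])
  then have "k \<bullet> h = k \<bullet> g" for k by (rule fun_cong)
  then have "(h - g) \<bullet> (h - g) = 0" by (simp add: inner_diff_right)
  then show "h = g" by simp
qed

lemma GDERIV_of_has_derivative:
  fixes f :: "'a::euclidean_space \<Rightarrow> real"
  assumes "(f has_derivative f') (at x)"
  shows "GDERIV f x :> (\<Sum>b\<in>Basis. f' b *\<^sub>R b)"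
proof -
  interpret f': linear f' using assms has_derivative_linear by blast
  have "f' h = h \<bullet> (\<Sum>b\<in>Basis. f' b *\<^sub>R b)" for h
  proof -
    have "f' h = f' (\<Sum>b\<in>Basis. (h \<bullet> b) *\<^sub>R b)" by (simp add: euclidean_representation)
    then show ?thesis by (simp add: f'.sum f'.scale inner_sum_right mult.commute)
  qed
  then show ?thesis using assms unfolding gderiv_def by (metis (no_types, lifting) ext)
qed

text \<open>For a continuous unknown the viscosity conditions thus concern the function
  itself.\<close>

lemma usc_envelope_continuous:
  assumes "continuous_on U u" "z \<in> U"
  shows "usc_envelope U u z = u z"
proof -
  have "(INF r\<in>{0<..}. SUP y\<in>U \<inter> ball z r. ereal (u y)) = ereal (u z)"
  proof (rule antisym)
    show "ereal (u z) \<le> (INF r\<in>{0<..}. SUP y\<in>U \<inter> ball z r. ereal (u y))"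
      using assms(2) by (auto intro!: INF_greatest SUP_upper)
    show "(INF r\<in>{0<..}. SUP y\<in>U \<inter> ball z r. ereal (u y)) \<le> ereal (u z)"
    proof (rule ereal_le_epsilon2)
      fix e :: real assume "0 < e"
      then obtain d where d: "d > 0" "\<forall>y\<in>U. dist y z < d \<longrightarrow> dist (u y) (u z) < e"
        using assms unfolding continuous_on_iff by metis
      have "(SUP y\<in>U \<inter> ball z d. ereal (u y)) \<le> ereal (u z) + ereal e"
      proof (rule SUP_least)
        fix y assume "y \<in> U \<inter> ball z d"
        then have "dist (u y) (u z) < e" using d by (simp add: dist_commute)
        then show "ereal (u y) \<le> ereal (u z) + ereal e" by (simp add: dist_real_def)
      qed
      then show "(INF r\<in>{0<..}. SUP y\<in>U \<inter> ball z r. ereal (u y)) \<le> ereal (u z) + ereal e"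
        using d(1) by (meson INF_lower2 greaterThan_iff)
    qed
  qed
  then show ?thesis by (simp add: usc_envelope_def)
qed

lemma lsc_envelope_eq_usc: "lsc_envelope U u z = - usc_envelope U (\<lambda>y. - u y) z"
proof -
  have "(INF r\<in>{0<..}. SUP y\<in>U \<inter> ball z r. ereal (- u y)) =
      - (SUP r\<in>{0<..}. INF y\<in>U \<inter> ball z r. ereal (u y))"
    unfolding uminus_ereal.simps(1)[symmetric] ereal_SUP_uminus_eq ereal_INF_uminus_eq ..
  then show ?thesis by (simp add: lsc_envelope_def usc_envelope_def)
qed

lemma lsc_envelope_continuous:
  assumes "continuous_on U u" "z \<in> U"
  shows "lsc_envelope U u z = u z"
  using usc_envelope_continuous[of U "\<lambda>y. - u y"] assms
  by (simp add: lsc_envelope_eq_usc continuous_on_minus)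

subsection \<open>Continuously differentiable functions\<close>

lemma blinfun_apply_0: "blinfun_apply 0 = (\<lambda>_. 0)"
  by auto

lemma C1_on_imp_continuous_on: "C1_on S f \<Longrightarrow> continuous_on S f"
  unfolding C1_on_def by (meson has_derivative_continuous continuous_on_eq_continuous_within)

lemma C2_on_imp_C1_on: "C2_on S f \<Longrightarrow> C1_on S f"
  unfolding C1_on_def C2_on_def
  by (metis C1_on_imp_continuous_on C1_on_def)

lemma C1_on_subset: "C1_on S f \<Longrightarrow> T \<subseteq> S \<Longrightarrow> C1_on T f"
  unfolding C1_on_def by (meson continuous_on_subset has_derivative_subset subsetD)

lemma C1_on_bounded_linear:
  assumes "bounded_linear f" shows "C1_on S f"
  unfolding C1_on_def
  by (rule exI[of _ "\<lambda>_. Blinfun f"])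
     (auto simp: bounded_linear_Blinfun_apply assms bounded_linear_imp_has_derivative)

lemma C1_on_const: "C1_on S (\<lambda>_. c)"
  unfolding C1_on_def by (rule exI[of _ "\<lambda>_. 0"]) (auto simp: blinfun_apply_0)

lemma C1_on_add:
  assumes "C1_on S f" "C1_on S g" shows "C1_on S (\<lambda>x. f x + g x)"
proof -
  obtain D E where "continuous_on S D" "\<forall>z\<in>S. (f has_derivative blinfun_apply (D z)) (at z within S)"
    "continuous_on S E" "\<forall>z\<in>S. (g has_derivative blinfun_apply (E z)) (at z within S)"
    using assms unfolding C1_on_def by metis
  then show ?thesis unfolding C1_on_def
    by (intro exI[of _ "\<lambda>z. D z + E z"])
       (auto intro!: continuous_intros derivative_eq_intros simp: blinfun.add_left)
qed

lemma C1_on_mult: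
  fixes f g :: "'a::real_normed_vector \<Rightarrow> real"
  assumes "C1_on S f" "C1_on S g" shows "C1_on S (\<lambda>x. f x * g x)"
proof -
  obtain D E where "continuous_on S D" "\<forall>z\<in>S. (f has_derivative blinfun_apply (D z)) (at z within S)"
    "continuous_on S E" "\<forall>z\<in>S. (g has_derivative blinfun_apply (E z)) (at z within S)"
    using assms unfolding C1_on_def by metis
  then show ?thesis unfolding C1_on_def
    using C1_on_imp_continuous_on[OF assms(1)] C1_on_imp_continuous_on[OF assms(2)]
    by (intro exI[of _ "\<lambda>z. f z *\<^sub>R E z + g z *\<^sub>R D z"])
       (auto intro!: continuous_intros derivative_eq_intros
         simp: blinfun.add_left blinfun.scaleR_left mult.commute)
qed

lemma C1_on_compose_real:
  fixes f :: "'a::real_normed_vector \<Rightarrow> real" and g :: "real \<Rightarrow> real"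
  assumes f: "C1_on S f" and g: "\<And>x. x \<in> f ` S \<Longrightarrow> (g has_real_derivative g' x) (at x)"
    and cont: "continuous_on (f ` S) g'"
  shows "C1_on S (\<lambda>x. g (f x))"
proof -
  obtain D where D: "continuous_on S D" "\<forall>z\<in>S. (f has_derivative blinfun_apply (D z)) (at z within S)"
    using f unfolding C1_on_def by metis
  have "((\<lambda>x. g (f x)) has_derivative blinfun_apply (g' (f z) *\<^sub>R D z)) (at z within S)"
    if "z \<in> S" for z
  proof -
    have "(g has_derivative (*) (g' (f z))) (at (f z))"
      using g that by (auto simp: has_field_derivative_def)
    from has_derivative_compose[OF D(2)[rule_format, OF that] this]
    show ?thesis by (simp add: blinfun.scaleR_left[abs_def])
  qed
  moreover have "continuous_on S (\<lambda>z. g' (f z) *\<^sub>R D z)"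
    using continuous_on_compose2[OF cont C1_on_imp_continuous_on[OF f]] D(1)
    by (auto intro!: continuous_intros)
  ultimately show ?thesis unfolding C1_on_def by blast
qed

lemma C1_on_cmult:
  fixes f :: "'a::real_normed_vector \<Rightarrow> real"
  shows "C1_on S f \<Longrightarrow> C1_on S (\<lambda>x. c * f x)"
  by (intro C1_on_mult C1_on_const)

lemma C1_on_uminus:
  fixes f :: "'a::real_normed_vector \<Rightarrow> real"
  shows "C1_on S f \<Longrightarrow> C1_on S (\<lambda>x. - f x)"
  using C1_on_cmult[of S f "-1"] by simp

lemma C1_on_diff:
  fixes f :: "'a::real_normed_vector \<Rightarrow> real"
  shows "C1_on S f \<Longrightarrow> C1_on S g \<Longrightarrow> C1_on S (\<lambda>x. f x - g x)"
  using C1_on_add[of S f "\<lambda>x. - g x"] C1_on_uminus[of S g] by simp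

text \<open>Squaring makes the positive part continuously differentiable while it still vanishes on
  a half-line. Both the bump function and the barrier are built from it.\<close>

definition pos_sq :: "real \<Rightarrow> real" where "pos_sq x = (max 0 x)\<^sup>2"

lemma pos_sq_deriv: "(pos_sq has_real_derivative 2 * max 0 x) (at x)"
proof -
  consider "x < 0" | "x > 0" | "x = 0" by linarith
  then show ?thesis
  proof cases
    case 1
    have "(pos_sq has_real_derivative 0) (at x)"
      by (rule has_field_derivative_transform_within_open[where S="{..<0}" and f="\<lambda>_. 0"])
         (use 1 in \<open>auto simp: pos_sq_def max_def\<close>)
    then show ?thesis using 1 by simp
  next
    case 2
    have "(pos_sq has_real_derivative 2 * x) (at x)"
      by (rule has_field_derivative_transform_within_open[where S="{0<..}" and f="\<lambda>x. x\<^sup>2"])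
         (use 2 in \<open>auto intro!: derivative_eq_intros simp: pos_sq_def max_def\<close>)
    then show ?thesis using 2 by simp
  next
    case 3
    have "((\<lambda>h. pos_sq h / h) \<longlongrightarrow> 0) (at 0)"
    proof (rule Lim_null_comparison[where g="\<lambda>h. \<bar>h\<bar>"])
      show "\<forall>\<^sub>F h in at 0. norm (pos_sq h / h) \<le> \<bar>h\<bar>"
        by (auto simp: eventually_at_filter pos_sq_def max_def power2_eq_square)
      show "((\<lambda>h::real. \<bar>h\<bar>) \<longlongrightarrow> 0) (at 0)"
        by (rule tendsto_rabs_zero) simp
    qed
    then show ?thesis using 3 by (simp add: DERIV_def pos_sq_def)
  qed
qed

lemma C1_on_pos_sq:
  assumes "C1_on S f" shows "C1_on S (\<lambda>x. pos_sq (f x))"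
  by (rule C1_on_compose_real[OF assms pos_sq_deriv]) (intro continuous_intros)

lemma C1_on_norm_sq:
  fixes z :: "'a::real_inner"
  shows "C1_on S (\<lambda>y. (norm (y - z))\<^sup>2)"
proof -
  have "((\<lambda>y. (norm (y - z))\<^sup>2) has_derivative
      blinfun_apply (2 *\<^sub>R blinfun_inner_left (y - z))) (at y within S)" for y
    unfolding power2_norm_eq_inner
    by (auto intro!: derivative_eq_intros simp: blinfun.scaleR_left inner_commute)
  moreover have "continuous_on S (\<lambda>y. 2 *\<^sub>R blinfun_inner_left (y - z))"
    by (intro continuous_intros bounded_linear.continuous_on[OF bounded_linear_blinfun_inner_left])
  ultimately show ?thesis unfolding C1_on_def by blast
qed

text \<open>Test functions have to be \<open>C1_on\<close> the whole domain of the equation, whereas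
  the barrier is so only near the touching point. A bump function repairs this without affecting a
  local extremum or a gradient at z.\<close>

lemma C1_cutoff_extension:
  fixes f :: "'a::real_inner \<Rightarrow> real"
  assumes "open U" "0 < r" and ball: "ball z r \<subseteq> U" and f: "C1_on (ball z r) f"
  obtains F s where "C1_on U F" "0 < s" "\<And>y. y \<in> ball z s \<Longrightarrow> F y = f y"
proof -
  \<comment> \<open>With this scaling \<open>k * (norm (y - z))\<^sup>2\<close> is 1 at distance r/2
    and 2 at distance r / sqrt 2, so \<open>b\<close> is 1 up to the former and 0 from the latter
    on.\<close>
  define k where "k = 4 / r\<^sup>2"
  define b where "b y = pos_sq (1 - pos_sq (k * (norm (y - z))\<^sup>2 - 1))" for y
  define F where "F y = (if y \<in> ball z r then b y * f y else 0)" for y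
  have b: "C1_on S b" for S
    unfolding b_def by (intro C1_on_pos_sq C1_on_diff C1_on_cmult C1_on_const C1_on_norm_sq)
  have "C1_on (ball z r) (\<lambda>y. b y * f y)"
    by (intro C1_on_mult b f)
  then obtain D where D: "continuous_on (ball z r) D"
    "\<And>y. y \<in> ball z r \<Longrightarrow> ((\<lambda>y. b y * f y) has_derivative blinfun_apply (D y)) (at y)"
    unfolding C1_on_def by (metis at_within_open open_ball)
  \<comment> \<open>Since 3/4 exceeds 1 / sqrt 2, the bump vanishes on \<open>V\<close>. The ball
    and \<open>V\<close> are open and cover the space, so smoothness of \<open>F\<close> is checked
    on each of them.\<close>
  define V where "V = - cball z (r * 3 / 4)"
  have bV: "b y = 0" if "y \<in> V" for y
  proof -
    have "r * 3 / 4 < norm (y - z)" using that by (simp add: V_def dist_norm norm_minus_commute)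
    then have "(r * 3 / 4)\<^sup>2 < (norm (y - z))\<^sup>2" using \<open>0 < r\<close> by (intro power_strict_mono) auto
    then have "k * (r * 3 / 4)\<^sup>2 < k * (norm (y - z))\<^sup>2"
      using \<open>0 < r\<close> by (intro mult_strict_left_mono) (auto simp: k_def)
    moreover have "k * (r * 3 / 4)\<^sup>2 = 9/4" using \<open>0 < r\<close> by (simp add: k_def power2_eq_square)
    ultimately have "1 < k * (norm (y - z))\<^sup>2 - 1" by simp
    then show ?thesis by (simp add: b_def pos_sq_def)
  qed
  have FV: "F y = 0" if "y \<in> V" for y using bV[OF that] by (simp add: F_def)
  have openV: "open V" by (auto simp: V_def)
  have cover: "y \<in> ball z r \<or> y \<in> V" for y using \<open>0 < r\<close> by (auto simp: V_def)
  define E where "E y = (if y \<in> ball z r then D y else 0)" for y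
  have EV: "E y = 0" if y: "y \<in> V" for y
  proof (cases "y \<in> ball z r")
    case True
    have "((\<lambda>y. b y * f y) has_derivative (\<lambda>_. 0)) (at y)"
      by (rule has_derivative_transform_within_open[where f="\<lambda>_. 0" and s=V])
         (use y bV openV in auto)
    then have "blinfun_apply (D y) = (\<lambda>_. 0)" using D(2)[OF True] has_derivative_unique by blast
    then show ?thesis using True by (auto simp: E_def intro: blinfun_eqI)
  qed (auto simp: E_def)
  have "(F has_derivative blinfun_apply (E y)) (at y)" for y
    using cover[of y]
  proof
    assume y: "y \<in> ball z r"
    show ?thesis
      by (rule has_derivative_transform_within_open[where f="\<lambda>y. b y * f y" and s="ball z r"])
         (use y D(2) in \<open>auto simp: E_def F_def\<close>)
  next
    assume y: "y \<in> V"
    show ?thesis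
      by (rule has_derivative_transform_within_open[where f="\<lambda>y. 0" and s=V])
         (use y openV EV FV in \<open>auto simp: blinfun_apply_0\<close>)
  qed
  moreover have "isCont E y" for y
    using cover[of y]
  proof
    assume y: "y \<in> ball z r"
    then have "isCont D y" using D(1) by (simp add: continuous_on_eq_continuous_at)
    moreover have "\<forall>\<^sub>F x in nhds y. E x = D x"
      using y by (intro eventually_nhds_in_open[THEN eventually_mono, of "ball z r"]) (auto simp: E_def)
    ultimately show ?thesis using isCont_cong by metis
  next
    assume y: "y \<in> V"
    have "\<forall>\<^sub>F x in nhds y. E x = 0"
      by (rule eventually_nhds_in_open[OF openV y, THEN eventually_mono]) (rule EV)
    then show ?thesis using isCont_cong[of E "\<lambda>_. 0" y] by simp
  qed
  ultimately have "continuous_on U E \<and> (\<forall>y\<in>U. (F has_derivative blinfun_apply (E y)) (at y within U))"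
    using continuous_at_imp_continuous_on[of U E] has_derivative_at_withinI by blast
  then have "C1_on U F" unfolding C1_on_def by blast
  moreover have "F y = f y" if "y \<in> ball z (r/2)" for y
  proof -
    have "norm (y - z) \<le> r / 2" using that by (simp add: dist_norm norm_minus_commute)
    then have "k * (norm (y - z))\<^sup>2 \<le> k * (r / 2)\<^sup>2"
      using \<open>0 < r\<close> by (intro mult_left_mono power_mono) (auto simp: k_def)
    also have "\<dots> = 1" using \<open>0 < r\<close> by (simp add: k_def power2_eq_square)
    finally have "b y = 1" by (simp add: b_def pos_sq_def)
    then show ?thesis using that \<open>0 < r\<close> by (simp add: F_def)
  qed
  ultimately show ?thesis using that[of F "r/2"] \<open>0 < r\<close> by auto
qed

subsection \<open>Comparison in a tube\<close>

text \<open>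
  In \<open>s + h\<close> with \<open>h = h(r)\<close>, \<open>r = s exp (K t)\<close> and \<open>A = r h'(r)\<close>, the derivative with respect to s is
  \<open>g = 1 + exp (K t) h'(r)\<close>, whence \<open>s (g - 1) = A\<close>. Where g is at least 1/2 the cut-off is inactive;
  elsewhere \<open>\<bar>s\<bar> \<le> 2 A\<close>, so that in both cases the error is absorbed by the time derivative \<open>K A\<close> with
  \<open>K = 6 L\<close>. The remaining term \<open>\<kappa>\<close> depends on time only.
\<close>

lemma hamiltonian_barrier:
  fixes p x :: "real^3"
  assumes "0 \<le> L" and lip: "\<And>y y'. norm (w t y - w t y') \<le> L * norm (y - y')"
    and eta: "\<And>r. 0 \<le> r \<Longrightarrow> 0 \<le> \<eta> r" "\<eta> 0 = 1" "\<And>r. r\<^sub>0 \<le> r \<Longrightarrow> \<eta> r = 0"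
    and p: "p \<noteq> 0" "4 * r\<^sub>0 \<le> (norm p)\<^sup>2"
    and eq: "q + w t (x - (s / (norm p)\<^sup>2) *\<^sub>R p) \<bullet> p = 0"
    and h: "0 \<le> h" "h \<le> A" "s * (g - 1) = A" and "0 \<le> \<kappa>"
  shows "\<kappa>' - L * \<kappa> \<le>
    hamiltonian w \<eta> (t, x) (s + h + \<kappa>) (g * q + 6 * L * A + \<kappa>', g *\<^sub>R p)"
proof -
  define P where "P = (norm p)\<^sup>2"
  define N where "N = g\<^sup>2 * P + \<eta> (g\<^sup>2 * P)"
  \<comment> \<open>The ratio of the unregularized to the regularized denominator; it is 1 where the
    cut-off is inactive.\<close>
  define \<theta> where "\<theta> = g\<^sup>2 * P / N"
  have P: "0 < P" "4 * r\<^sub>0 \<le> P" using p by (auto simp: P_def)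
  have norm_q: "(norm (g *\<^sub>R p))\<^sup>2 = g\<^sup>2 * P"
    by (simp add: P_def power_mult_distrib)
  have "0 \<le> g\<^sup>2 * P" using P by simp
  \<comment> \<open>For g = 0 positivity comes from \<open>\<eta> 0 = 1\<close> alone.\<close>
  have N: "0 < N"
  proof (cases "g = 0")
    case False
    then have "0 < g\<^sup>2 * P" using P by simp
    then show ?thesis using eta(1)[of "g\<^sup>2 * P"] by (simp add: N_def)
  qed (simp add: N_def eta)
  have \<theta>: "0 \<le> \<theta>" "\<theta> \<le> 1"
    using N \<open>0 \<le> g\<^sup>2 * P\<close> eta(1)[of "g\<^sup>2 * P"] by (auto simp: \<theta>_def N_def)
  define y1 where "y1 = x - ((s + h + \<kappa>) / N) *\<^sub>R (g *\<^sub>R p)"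
  define y0 where "y0 = x - (s / P) *\<^sub>R p"
  have y: "y1 - y0 = (s / P - (s + h + \<kappa>) * g / N) *\<^sub>R p"
    by (simp add: y1_def y0_def algebra_simps)
  have "\<bar>(w t y1 - w t y0) \<bullet> (g *\<^sub>R p)\<bar> \<le> norm (w t y1 - w t y0) * norm (g *\<^sub>R p)"
    by (rule Cauchy_Schwarz_ineq2)
  also have "\<dots> \<le> L * norm (y1 - y0) * norm (g *\<^sub>R p)"
    by (intro mult_right_mono lip) auto
  also have "\<dots> = L * (\<bar>s / P - (s + h + \<kappa>) * g / N\<bar> * (P * \<bar>g\<bar>))"
    by (simp add: y P_def power2_eq_square)
  also have "\<bar>s / P - (s + h + \<kappa>) * g / N\<bar> * (P * \<bar>g\<bar>) =
      \<bar>(s / P - (s + h + \<kappa>) * g / N) * (P * g)\<bar>"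
    using P by (simp add: abs_mult)
  also have "(s / P - (s + h + \<kappa>) * g / N) * (P * g) = s * g - (s + h + \<kappa>) * \<theta>"
  proof -
    have "s / P * (P * g) = s * g" using P by simp
    moreover have "(s + h + \<kappa>) * g / N * (P * g) = (s + h + \<kappa>) * \<theta>"
      by (simp add: \<theta>_def power2_eq_square)
    ultimately show ?thesis by (simp only: left_diff_distrib)
  qed
  finally have 1: "\<bar>(w t y1 - w t y0) \<bullet> (g *\<^sub>R p)\<bar> \<le> L * \<bar>s * g - (s + h + \<kappa>) * \<theta>\<bar>" .
  \<comment> \<open>In the case of an active cut-off each of \<open>s * g\<close> and
    \<open>(s + h) * \<theta>\<close> contributes up to 3 A; otherwise A would do. This is the
    origin of the 6 in K = 6 L.\<close>
  have "\<bar>s * g - (s + h) * \<theta>\<bar> \<le> 6 * A"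
  proof (cases "\<theta> = 1")
    case True
    have "s * g = s + A" using h(3) by (simp add: algebra_simps)
    then have "s * g - (s + h) * \<theta> = A - h" using True by simp
    then show ?thesis using h(1,2) by linarith
  next
    case False
    have "g < 1/2"
    proof (rule ccontr)
      assume "\<not> g < 1/2"
      \<comment> \<open>The factor 4 in the lower bound on the gradient is spent here: halving
        \<open>p\<close> still leaves its square above the threshold
        \<open>r\<^sub>0\<close>.\<close>
      then have "(1/2)\<^sup>2 \<le> g\<^sup>2" by (intro power_mono) auto
      then have "(1/2)\<^sup>2 * P \<le> g\<^sup>2 * P" using P by (intro mult_right_mono) auto
      moreover have "(1/2)\<^sup>2 * P = P / 4" by (simp add: power2_eq_square)
      ultimately have "r\<^sub>0 \<le> g\<^sup>2 * P" using P(2) by linarith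
      then have "N = g\<^sup>2 * P" using eta(3) by (simp add: N_def)
      then have "\<theta> = N / N" by (metis \<theta>_def)
      then show False using N False by simp
    qed
    then have "\<bar>s\<bar> * (1/2) \<le> \<bar>s\<bar> * \<bar>g - 1\<bar>" by (intro mult_left_mono) auto
    also have "\<dots> = A" using h by (simp flip: abs_mult)
    finally have s: "\<bar>s\<bar> \<le> 2 * A" by simp
    have "\<bar>(s + h) * \<theta>\<bar> \<le> \<bar>s + h\<bar>"
      using mult_left_mono[OF \<theta>(2), of "\<bar>s + h\<bar>"] \<theta>(1) by (simp add: abs_mult)
    moreover have "s * g = s + A" using h(3) by (simp add: algebra_simps)
    ultimately show ?thesis using s h(1,2) by linarith
  qed
  moreover have "\<bar>\<kappa> * \<theta>\<bar> \<le> \<kappa>"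
    using mult_left_mono[OF \<theta>(2), of \<kappa>] \<theta>(1) \<open>0 \<le> \<kappa>\<close> by (simp add: abs_mult)
  ultimately have "\<bar>s * g - (s + h + \<kappa>) * \<theta>\<bar> \<le> 6 * A + \<kappa>"
    by (simp add: algebra_simps)
  from mult_left_mono[OF this \<open>0 \<le> L\<close>]
  have "L * \<bar>s * g - (s + h + \<kappa>) * \<theta>\<bar> \<le> 6 * L * A + L * \<kappa>"
    by (simp add: algebra_simps)
  with 1 have 2: "- (6 * L * A + L * \<kappa>) \<le> (w t y1 - w t y0) \<bullet> (g *\<^sub>R p)" by linarith
  have "g * (q + w t y0 \<bullet> p) = 0" using eq by (simp add: y0_def P_def)
  then have 3: "g * q + w t y0 \<bullet> (g *\<^sub>R p) = 0" by (simp add: algebra_simps)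
  have "hamiltonian w \<eta> (t, x) (s + h + \<kappa>) (g * q + 6 * L * A + \<kappa>', g *\<^sub>R p) =
      g * q + 6 * L * A + \<kappa>' + w t y1 \<bullet> (g *\<^sub>R p)"
    unfolding hamiltonian_def fst_conv snd_conv norm_q y1_def N_def ..
  then show ?thesis using 2 3 unfolding inner_diff_left by linarith
qed

text \<open>The gradient is arranged in the shape that \<open>hamiltonian_barrier\<close> expects.
  The coefficient \<open>L + 1 / (T - fst z)\<close> is the logarithmic derivative of the last
  summand; its excess over L makes the final inequality strict.\<close>

lemma GDERIV_test_function:
  fixes \<phi> :: "real \<times> 'a::real_inner \<Rightarrow> real" and K C a c L T :: real
  assumes \<phi>: "GDERIV \<phi> z :> (q, p)" and "fst z \<noteq> T"
  defines "r \<equiv> \<phi> z * exp (K * fst z)"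
  defines "h' \<equiv> C * (2 * max 0 (r\<^sup>2 - a\<^sup>2)) * (2 * r)"
  shows "GDERIV (\<lambda>z. \<phi> z + C * pos_sq ((\<phi> z * exp (K * fst z))\<^sup>2 - a\<^sup>2) +
      c * exp (L * fst z) / (T - fst z)) z :>
    ((1 + exp (K * fst z) * h') * q + K * (r * h') +
       (L + 1 / (T - fst z)) * (c * exp (L * fst z) / (T - fst z)),
     (1 + exp (K * fst z) * h') *\<^sub>R p)"
proof -
  have fst: "GDERIV fst z :> (1, 0)"
    unfolding gderiv_def by (auto intro!: derivative_eq_intros simp: inner_prod_def)
  have e: "GDERIV (\<lambda>z. exp (k * fst z)) z :> (k * exp (k * fst z)) *\<^sub>R (1, 0)" for k
    by (rule GDERIV_DERIV_compose[OF fst]) (auto intro!: derivative_eq_intros)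
  have r: "GDERIV (\<lambda>z. \<phi> z * exp (K * fst z)) z :>
      (exp (K * fst z) *\<^sub>R (q, p) + (K * r) *\<^sub>R (1, 0))"
    by (rule GDERIV_subst[OF GDERIV_mult[OF \<phi> e]]) (simp add: r_def)
  have h: "DERIV (\<lambda>r. C * pos_sq (r\<^sup>2 - a\<^sup>2)) r :> h'"
    unfolding h'_def
    by (rule DERIV_cong[OF DERIV_cmult[OF DERIV_chain2[OF pos_sq_deriv]]])
       (auto intro!: derivative_eq_intros)
  have hr: "GDERIV (\<lambda>z. C * pos_sq ((\<phi> z * exp (K * fst z))\<^sup>2 - a\<^sup>2)) z :>
      h' *\<^sub>R (exp (K * fst z) *\<^sub>R (q, p) + (K * r) *\<^sub>R (1, 0))"
    by (rule GDERIV_DERIV_compose[OF r]) (use h in \<open>simp add: r_def\<close>)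
  have \<kappa>: "GDERIV (\<lambda>z. c * exp (L * fst z) / (T - fst z)) z :>
      ((L + 1 / (T - fst z)) * (c * exp (L * fst z) / (T - fst z))) *\<^sub>R (1, 0)"
    by (rule GDERIV_DERIV_compose[OF fst, where g="\<lambda>t. c * exp (L * t) / (T - t)"])
       (use \<open>fst z \<noteq> T\<close> in \<open>auto intro!: derivative_eq_intros simp: field_simps power2_eq_square\<close>)
  show ?thesis
    by (rule GDERIV_subst[OF GDERIV_add[OF GDERIV_add[OF \<phi> hr] \<kappa>]])
       (simp add: algebra_simps scaleR_add_left)
qed

text \<open>A positive gap would let a barrier touch \<open>u\<close> from above at an interior
  point, where \<open>hamiltonian_barrier\<close> contradicts the subsolution condition. The
  assumption \<open>inner\<close> stands in for boundary values: where the modulus of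
  \<open>\<phi>\<close> is below \<open>\<delta>\<close>, the lateral boundary of \<open>Q\<close>
  is out of reach.\<close>

lemma tube_comparison:
  fixes \<phi> u :: "real \<times> (real^3) \<Rightarrow> real"
  assumes "0 \<le> L" and lip: "\<And>t y y'. 0 \<le> t \<Longrightarrow> norm (w t y - w t y') \<le> L * norm (y - y')"
    and eta: "\<And>r. 0 \<le> r \<Longrightarrow> 0 \<le> \<eta> r" "\<eta> 0 = 1" "\<And>r. r\<^sub>0 \<le> r \<Longrightarrow> \<eta> r = 0"
    and "open U"
    and sub: "\<And>f z. C1_on U f \<Longrightarrow> z \<in> U \<Longrightarrow> local_max_at U (\<lambda>y. u y - f y) z \<Longrightarrow>
      hamiltonian w \<eta> z (u z) (grad f z) \<le> 0"
    and Q: "compact Q" "Q \<subseteq> {0..T} \<times> UNIV" "interior Q \<subseteq> U"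
    and cont: "continuous_on Q u" "continuous_on Q \<phi>"
    and "0 < \<delta>"
    and inner: "\<And>t x. (t, x) \<in> Q \<Longrightarrow> 0 < t \<Longrightarrow> t < T \<Longrightarrow> \<bar>\<phi> (t, x)\<bar> < \<delta> \<Longrightarrow> (t, x) \<in> interior Q"
    and C1: "C1_on (interior Q) \<phi>"
    and pde: "\<And>t x. (t, x) \<in> interior Q \<Longrightarrow> \<exists>q p. GDERIV \<phi> (t, x) :> (q, p) \<and> p \<noteq> 0 \<and>
      4 * r\<^sub>0 \<le> (norm p)\<^sup>2 \<and> q + w t (x - (\<phi> (t, x) / (norm p)\<^sup>2) *\<^sub>R p) \<bullet> p = 0"
    and init: "\<And>x. (0, x) \<in> Q \<Longrightarrow> u (0, x) \<le> \<phi> (0, x)"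
    and z0: "(t\<^sub>0, x\<^sub>0) \<in> Q" "t\<^sub>0 < T" "\<bar>\<phi> (t\<^sub>0, x\<^sub>0)\<bar> * exp (6 * L * t\<^sub>0) \<le> \<delta> / 4"
  shows "u (t\<^sub>0, x\<^sub>0) \<le> \<phi> (t\<^sub>0, x\<^sub>0)"
proof (rule ccontr)
  assume less: "\<not> ?thesis"
  \<comment> \<open>The barrier term \<open>h\<close> vanishes for \<bar>r\<bar> \<le> a, a region
    containing the given point. The rim is \<bar>r\<bar> = b, and b < \<delta> allows
    \<open>inner\<close> to be applied inside it.\<close>
  define K a b where "K = 6 * L" and "a = \<delta> / 4" and "b = \<delta> / 2"
  have ab: "0 < a" "a < b" "b < \<delta>" using \<open>0 < \<delta>\<close> by (auto simp: a_def b_def)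
  have "continuous_on Q (\<lambda>z. u z - \<phi> z)" by (intro continuous_intros cont)
  then have "bounded ((\<lambda>z. u z - \<phi> z) ` Q)"
    using Q(1) compact_continuous_image compact_imp_bounded by blast
  then obtain M where M: "0 < M" "\<And>z. z \<in> Q \<Longrightarrow> u z - \<phi> z \<le> M"
    unfolding bounded_pos by (force simp: abs_le_iff)
  \<comment> \<open>Chosen so that \<open>h\<close> exceeds the largest possible gap
    \<open>M\<close> by 1 on the rim.\<close>
  define C where "C = (M + 1) / (b\<^sup>2 - a\<^sup>2)\<^sup>2"
  have "a\<^sup>2 < b\<^sup>2" using ab by (intro power_strict_mono) auto
  then have C: "0 < C" "C * pos_sq (b\<^sup>2 - a\<^sup>2) = M + 1"
    using M by (auto simp: C_def pos_sq_def)
  define r where "r z = \<phi> z * exp (K * fst z)" for z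
  define h where "h z = C * pos_sq ((r z)\<^sup>2 - a\<^sup>2)" for z
  \<comment> \<open>The weight is c / \<kappa> for the function \<kappa> below. Its zero at time T
    excludes a positive maximum at the final time.\<close>
  define \<omega> where "\<omega> z = (u z - (\<phi> z + h z)) * ((T - fst z) * exp (- L * fst z))" for z
  have h_nonneg: "0 \<le> h z" for z using C by (simp add: h_def pos_sq_def)
  define R where "R = {z \<in> Q. \<bar>r z\<bar> \<in> {0..b}}"
  have cont_r: "continuous_on Q r"
    unfolding r_def by (intro continuous_intros cont)
  have "closed R"
    using continuous_closed_preimage[OF continuous_on_rabs[OF cont_r] compact_imp_closed[OF Q(1)], of "{0..b}"]
    by (simp add: R_def vimage_def Int_def)
  moreover have "R = Q \<inter> R" by (auto simp: R_def)
  ultimately have "compact R"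
    using compact_Int_closed[OF Q(1)] by metis
  have "continuous_on Q \<omega>"
    unfolding \<omega>_def h_def pos_sq_def by (intro continuous_intros cont cont_r)
  then have cont_\<omega>: "continuous_on R \<omega>" by (rule continuous_on_subset) (auto simp: R_def)
  have z0R: "(t\<^sub>0, x\<^sub>0) \<in> R"
    using z0 ab by (auto simp: R_def r_def K_def a_def abs_mult b_def)
  then have "R \<noteq> {}" by blast
  from continuous_attains_sup[OF \<open>compact R\<close> this cont_\<omega>]
  obtain z where z: "z \<in> R" "\<And>y. y \<in> R \<Longrightarrow> \<omega> y \<le> \<omega> z"
    by blast
  obtain t x where tx: "z = (t, x)" by fastforce
  have zQ: "z \<in> Q" "0 \<le> t" "t \<le> T" "\<bar>r z\<bar> \<le> b"
    using z(1) Q(2) by (auto simp: R_def tx)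
  have "\<bar>r (t\<^sub>0, x\<^sub>0)\<bar> \<le> \<bar>a\<bar>" using z0(3) ab by (simp add: r_def K_def a_def abs_mult)
  then have "(r (t\<^sub>0, x\<^sub>0))\<^sup>2 \<le> a\<^sup>2" by (simp only: abs_le_square_iff)
  then have "0 < \<omega> (t\<^sub>0, x\<^sub>0)"
    using less z0(2) by (simp add: \<omega>_def h_def pos_sq_def)
  with z(2)[OF z0R] have "0 < \<omega> z" by linarith
  then have "t < T" and pos: "0 < u z - (\<phi> z + h z)"
    using zQ by (auto simp: \<omega>_def tx zero_less_mult_iff mult_less_0_iff)
  \<comment> \<open>This is the smallest constant for which the test function f below stays above u; it touches u at z.\<close>
  define c where "c = \<omega> z"
  define \<kappa> where "\<kappa> z = c * exp (L * fst z) / (T - fst z)" for z :: "real \<times> (real^3)"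
  define f where "f z = \<phi> z + C * pos_sq ((\<phi> z * exp (K * fst z))\<^sup>2 - a\<^sup>2) +
    c * exp (L * fst z) / (T - fst z)" for z
  have f_eq: "f z = \<phi> z + h z + \<kappa> z" for z
    by (simp add: f_def r_def \<kappa>_def h_def)
  have \<omega>_eq: "u y - f y = (\<omega> y - c) * (exp (L * fst y) / (T - fst y))" if "fst y < T" for y
    using that by (simp add: f_eq \<omega>_def \<kappa>_def exp_minus field_simps)
  have uf: "u z = f z" using \<omega>_eq[of z] \<open>t < T\<close> by (simp add: tx c_def)
  have uf_le: "u y \<le> f y" if "y \<in> R" "fst y < T" for y
    using \<omega>_eq[OF that(2)] z(2)[OF that(1)] that(2)
    by (smt (verit) c_def divide_pos_pos exp_gt_zero mult_nonneg_nonneg mult_minus_left)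
  have \<kappa>_pos: "0 < \<kappa> z" using \<open>0 < \<omega> z\<close> \<open>t < T\<close> by (simp add: \<kappa>_def tx c_def)
  have "\<bar>r z\<bar> < b"
  proof (rule ccontr)
    assume "\<not> \<bar>r z\<bar> < b"
    then have "\<bar>r z\<bar> = b" using zQ by simp
    then have "(r z)\<^sup>2 = b\<^sup>2" by (metis power2_abs)
    then show False using pos M(2)[OF zQ(1)] C by (simp add: h_def)
  qed
  have "0 < t"
  proof (rule ccontr)
    assume "\<not> 0 < t"
    then have "u z \<le> \<phi> z" using zQ init by (auto simp: tx)
    then show False using pos h_nonneg[of z] by simp
  qed
  have "\<bar>\<phi> z\<bar> \<le> \<bar>\<phi> z\<bar> * exp (K * t)"
    using zQ \<open>0 \<le> L\<close> by (simp add: mult_le_cancel_left1 K_def)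
  also have "\<dots> = \<bar>r z\<bar>" by (simp add: r_def abs_mult tx)
  finally have "z \<in> interior Q"
    using inner[of t x] zQ \<open>0 < t\<close> \<open>t < T\<close> \<open>\<bar>r z\<bar> < b\<close> ab by (auto simp: tx)
  define V where "V = {y \<in> interior Q. \<bar>r y\<bar> \<in> {..<b}}"
  have "continuous_on (interior Q) (\<lambda>z. \<bar>r z\<bar>)"
    using continuous_on_rabs[OF cont_r] interior_subset by (rule continuous_on_subset)
  then have "open V"
    using continuous_open_preimage[of "interior Q" "\<lambda>z. \<bar>r z\<bar>" "{..<b}"]
    by (simp add: V_def vimage_def Int_def)
  moreover have "z \<in> V"
    using \<open>z \<in> interior Q\<close> \<open>\<bar>r z\<bar> < b\<close> by (auto simp: V_def)
  ultimately obtain \<rho> where \<rho>: "0 < \<rho>" "ball z \<rho> \<subseteq> V" using open_contains_ball by blast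
  have VR: "V \<subseteq> R" using interior_subset[of Q] by (auto simp: V_def R_def)
  have "interior Q \<subseteq> {0<..<T} \<times> UNIV"
    using interior_mono[OF Q(2)] by (simp add: interior_Times)
  then have less_T: "fst y < T" if "y \<in> V" for y using that by (auto simp: V_def)
  have "C1_on (ball z \<rho>) f"
  proof -
    have \<phi>: "C1_on (ball z \<rho>) \<phi>"
      by (rule C1_on_subset[OF C1]) (use \<rho> in \<open>auto simp: V_def\<close>)
    have fst: "C1_on (ball z \<rho>) fst" by (intro C1_on_bounded_linear bounded_linear_fst)
    have e: "C1_on (ball z \<rho>) (\<lambda>z. exp (k * fst z))" for k
      by (rule C1_on_compose_real[where g="\<lambda>t. exp (k * t)" and g'="\<lambda>t. k * exp (k * t)", OF fst])
         (auto intro!: derivative_eq_intros continuous_intros)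
    have i: "C1_on (ball z \<rho>) (\<lambda>z. 1 / (T - fst z))"
      by (rule C1_on_compose_real[where g="\<lambda>t. 1 / (T - t)" and g'="\<lambda>t. 1 / (T - t)\<^sup>2", OF fst])
         (use \<rho> less_T in \<open>fastforce intro!: derivative_eq_intros continuous_intros
           simp: power2_eq_square\<close>)+
    have "C1_on (ball z \<rho>) (\<lambda>z. \<phi> z + C * pos_sq ((\<phi> z * exp (K * fst z)) * (\<phi> z * exp (K * fst z)) - a\<^sup>2) +
        c * exp (L * fst z) * (1 / (T - fst z)))"
      by (intro C1_on_add C1_on_cmult C1_on_mult C1_on_pos_sq C1_on_diff C1_on_const \<phi> e i)
    then show ?thesis by (simp add: f_def[abs_def] power2_eq_square)
  qed
  moreover have "ball z \<rho> \<subseteq> U" using \<rho>(2) Q(3) by (auto simp: V_def)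
  ultimately obtain F s where F: "C1_on U F" "0 < s" "\<And>y. y \<in> ball z s \<Longrightarrow> F y = f y"
    using C1_cutoff_extension[OF \<open>open U\<close> \<rho>(1)] by metis
  have zU: "z \<in> U" using \<open>z \<in> interior Q\<close> Q(3) by auto
  have "local_max_at U (\<lambda>y. u y - F y) z"
    unfolding local_max_at_def
  proof (intro exI[of _ "min \<rho> s"] conjI ballI)
    fix y assume y: "y \<in> U \<inter> ball z (min \<rho> s)"
    then have "y \<in> V" using \<rho>(2) by auto
    then have "y \<in> R" "fst y < T" using VR less_T by blast+
    then show "u y - F y \<le> u z - F z" using uf uf_le F(2,3) y by auto
  qed (use \<rho> F in auto)
  from sub[OF F(1) zU this] have le: "hamiltonian w \<eta> z (u z) (grad F z) \<le> 0" .
  obtain q p where qp: "GDERIV \<phi> z :> (q, p)" "p \<noteq> 0" "4 * r\<^sub>0 \<le> (norm p)\<^sup>2"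
    "q + w t (x - (\<phi> z / (norm p)\<^sup>2) *\<^sub>R p) \<bullet> p = 0"
    using pde \<open>z \<in> interior Q\<close> unfolding tx by blast
  define h' where "h' = C * (2 * max 0 ((r z)\<^sup>2 - a\<^sup>2)) * (2 * r z)"
  define A where "A = r z * h'"
  define g where "g = 1 + exp (K * t) * h'"
  have "GDERIV f z :> (g * q + K * A + (L + 1 / (T - t)) * \<kappa> z, g *\<^sub>R p)"
    using GDERIV_test_function[OF qp(1), of T C K a c L] \<open>t < T\<close>
    by (simp add: f_def[abs_def] \<kappa>_def tx g_def A_def h'_def r_def)
  then have "GDERIV F z :> (g * q + K * A + (L + 1 / (T - t)) * \<kappa> z, g *\<^sub>R p)"
    unfolding gderiv_def
    by (rule has_derivative_transform_within_open[where s="ball z s"]) (use F in auto)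
  note grad_F = grad_eqI[OF this]
  \<comment> \<open>With m the positive part of r^2 - a^2 the claim is C m^2 \<le> 4 C m r^2, which
    follows from m \<le> 4 r^2.\<close>
  have hA: "h z \<le> A"
  proof -
    define m where "m = max 0 ((r z)\<^sup>2 - a\<^sup>2)"
    have "(r z)\<^sup>2 - a\<^sup>2 \<le> 4 * (r z)\<^sup>2"
      using zero_le_power2[of "r z"] zero_le_power2[of a] by linarith
    then have m: "0 \<le> m" "m \<le> 4 * (r z)\<^sup>2" by (auto simp: m_def)
    then have "C * (m * m) \<le> C * (m * (4 * (r z)\<^sup>2))" using C by (intro mult_left_mono) auto
    moreover have "h z = C * (m * m)"
      by (simp add: h_def pos_sq_def m_def power2_eq_square)
    moreover have "A = C * (m * (4 * (r z)\<^sup>2))"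
      unfolding A_def h'_def m_def[symmetric] by (simp add: power2_eq_square)
    ultimately show ?thesis by simp
  qed
  have "\<phi> z * (g - 1) = A" by (simp add: g_def A_def r_def tx)
  then have "(L + 1 / (T - t)) * \<kappa> z - L * \<kappa> z \<le>
      hamiltonian w \<eta> (t, x) (\<phi> z + h z + \<kappa> z)
        (g * q + 6 * L * A + (L + 1 / (T - t)) * \<kappa> z, g *\<^sub>R p)"
    using zQ(2) \<kappa>_pos
    by (intro hamiltonian_barrier[where r\<^sub>0=r\<^sub>0] \<open>0 \<le> L\<close> lip eta qp h_nonneg hA) auto
  also have "\<dots> \<le> 0" using le unfolding grad_F uf f_eq by (simp add: tx K_def)
  \<comment> \<open>The terms with L cancel, and what remains is the excess from the factor 1 / (T -
    t).\<close>
  finally have "\<kappa> z / (T - t) \<le> 0" by (simp add: algebra_simps)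
  then show False using \<kappa>_pos \<open>t < T\<close> by (simp add: divide_le_0_iff)
qed

subsection \<open>The flow\<close>

text \<open>Gronwall's argument for the squared distance m, which stays differentiable where
  trajectories meet. The bound \<bar>m'\<bar> \<le> 2 L m is two-sided, so it also works backward in
  time; at distance 0 it yields uniqueness.\<close>

lemma trajectories_dist:
  fixes y z :: "real \<Rightarrow> 'a::real_inner"
  assumes lip: "\<And>s. 0 \<le> s \<Longrightarrow> L-lipschitz_on S (v s)"
    and y: "\<And>s. 0 \<le> s \<Longrightarrow> y s \<in> S"
      "\<And>s. 0 \<le> s \<Longrightarrow> (y has_vector_derivative v s (y s)) (at s within {0..})"
    and z: "\<And>s. 0 \<le> s \<Longrightarrow> z s \<in> S"
      "\<And>s. 0 \<le> s \<Longrightarrow> (z has_vector_derivative v s (z s)) (at s within {0..})"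
    and "0 \<le> a" "0 \<le> b"
  shows "dist (y b) (z b) \<le> exp (L * \<bar>b - a\<bar>) * dist (y a) (z a)"
proof -
  define m where "m s = (y s - z s) \<bullet> (y s - z s)" for s
  define m' where "m' s = 2 * ((y s - z s) \<bullet> (v s (y s) - v s (z s)))" for s
  have cont: "continuous_on {0..} y" "continuous_on {0..} z"
    using y(2) z(2) by (auto simp: continuous_on_eq_continuous_within
        intro: has_vector_derivative_continuous)
  \<comment> \<open>At time 0 only a one-sided derivative is available. The monotonicity arguments
    therefore use derivatives in the open interval and continuity up to its ends.\<close>
  have cont_m: "continuous_on {c..d} m" if "0 \<le> c" for c d
  proof -
    have "continuous_on {0..} m" unfolding m_def by (intro continuous_intros cont)
    then show ?thesis by (rule continuous_on_subset) (use that in auto)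
  qed
  have m: "(m has_real_derivative m' s) (at s)" if "0 < s" for s
  proof -
    have "at s within {0..} = at s" using that by (intro at_within_interior) (simp add: interior_real_atLeast)
    with y(2)[of s] z(2)[of s] that
    have "(y has_vector_derivative v s (y s)) (at s)" "(z has_vector_derivative v s (z s)) (at s)"
      by simp_all
    then show ?thesis
      unfolding m_def[abs_def] m'_def has_vector_derivative_def has_field_derivative_def
      by (auto intro!: derivative_eq_intros simp: inner_commute inner_diff_left inner_diff_right algebra_simps)
  qed
  have bound: "\<bar>m' s\<bar> \<le> 2 * L * m s" if "0 \<le> s" for s
  proof -
    have "\<bar>(y s - z s) \<bullet> (v s (y s) - v s (z s))\<bar> \<le> norm (y s - z s) * norm (v s (y s) - v s (z s))"
      by (rule Cauchy_Schwarz_ineq2)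
    also have "\<dots> \<le> norm (y s - z s) * (L * norm (y s - z s))"
      using lipschitz_onD[OF lip[OF that] y(1)[OF that] z(1)[OF that]]
      by (intro mult_left_mono) (auto simp: dist_norm)
    also have "\<dots> = L * m s" by (simp add: m_def dot_square_norm power2_eq_square)
    finally show ?thesis by (simp add: m'_def abs_mult)
  qed
  have e: "((\<lambda>s. m s * exp (k * s)) has_real_derivative (m' s + k * m s) * exp (k * s)) (at s)"
    if "0 < s" for s k
    by (auto intro!: derivative_eq_intros m that simp: algebra_simps)
  have c: "continuous_on {c..d} (\<lambda>s. m s * exp (k * s))" if "0 \<le> c" for c d k
    by (intro continuous_intros cont_m that)
  have main: "m b \<le> m a * exp (2 * L * \<bar>b - a\<bar>)"
  proof (cases "a \<le> b")
    case True
    have "m b * exp ((- 2 * L) * b) \<le> m a * exp ((- 2 * L) * a)"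
    proof (rule DERIV_nonpos_imp_decreasing_open[OF True _ c[OF \<open>0 \<le> a\<close>]])
      fix s assume "a < s" "s < b"
      then have s: "0 < s" using \<open>0 \<le> a\<close> by simp
      moreover have "m' s + (- 2 * L) * m s \<le> 0" using bound[of s] s by (simp add: abs_le_iff)
      ultimately show "\<exists>k. ((\<lambda>s. m s * exp ((- 2 * L) * s)) has_real_derivative k) (at s) \<and> k \<le> 0"
        using e[of s "- 2 * L"] by (meson exp_ge_zero mult_nonpos_nonneg)
    qed
    then have "m b * exp ((- 2 * L) * b) * exp (2 * L * b) \<le> m a * exp ((- 2 * L) * a) * exp (2 * L * b)"
      by (intro mult_right_mono) auto
    then show ?thesis using True by (simp add: mult.assoc algebra_simps flip: exp_add)
  next
    case False
    have "m b * exp (2 * L * b) \<le> m a * exp (2 * L * a)"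
    proof (rule DERIV_nonneg_imp_increasing_open[OF _ _ c[OF \<open>0 \<le> b\<close>]])
      show "b \<le> a" using False by simp
      fix s assume "b < s" "s < a"
      then have s: "0 < s" using \<open>0 \<le> b\<close> by simp
      moreover have "m' s + 2 * L * m s \<ge> 0" using bound[of s] s by (simp add: abs_le_iff)
      ultimately show "\<exists>k. ((\<lambda>s. m s * exp (2 * L * s)) has_real_derivative k) (at s) \<and> 0 \<le> k"
        using e[of s "2 * L"] by (meson exp_ge_zero mult_nonneg_nonneg)
    qed
    then have "m b * exp (2 * L * b) * exp (- (2 * L * b)) \<le> m a * exp (2 * L * a) * exp (- (2 * L * b))"
      by (intro mult_right_mono) auto
    then show ?thesis using False by (simp add: mult.assoc algebra_simps flip: exp_add)
  qed
  have "(dist (y b) (z b))\<^sup>2 = m b" by (simp add: m_def dist_norm dot_square_norm)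
  also note main
  also have "m a * exp (2 * L * \<bar>b - a\<bar>) = (exp (L * \<bar>b - a\<bar>) * dist (y a) (z a))\<^sup>2"
    by (simp add: m_def dist_norm dot_square_norm power_mult_distrib exp_double[symmetric] mult.assoc)
  finally show ?thesis by (rule power2_le_imp_le) simp
qed

lemma trajectory_speed:
  fixes y :: "real \<Rightarrow> 'a::real_normed_vector"
  assumes "\<And>s. s \<in> {0..T} \<Longrightarrow> (y has_vector_derivative y' s) (at s within {0..})"
    and "\<And>s. s \<in> {0..T} \<Longrightarrow> norm (y' s) \<le> M"
    and "a \<in> {0..T}" "b \<in> {0..T}"
  shows "dist (y a) (y b) \<le> M * \<bar>a - b\<bar>"
proof -
  have "norm (y a - y b) \<le> M * norm (a - b)"
  proof (rule differentiable_bound[where S="{0..T}" and f'="\<lambda>s h. h *\<^sub>R y' s"])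
    fix s assume s: "s \<in> {0..T}"
    then show "(y has_derivative (\<lambda>h. h *\<^sub>R y' s)) (at s within {0..T})"
      using assms(1)[OF s] unfolding has_vector_derivative_def
      by (rule_tac has_derivative_subset) auto
    show "onorm (\<lambda>h. h *\<^sub>R y' s) \<le> M"
      by (rule onorm_le) (use mult_right_mono[OF assms(2)[OF s]] in \<open>simp add: mult.commute[of "\<bar>_\<bar>"]\<close>)
  qed (use assms in auto)
  then show ?thesis by (simp add: dist_norm)
qed

lemma flow_dist:
  assumes flow: "is_flow \<Omega> v X" and lip: "\<And>s. 0 \<le> s \<Longrightarrow> L-lipschitz_on (closure \<Omega>) (v s)"
    and "0 \<le> s" "0 \<le> \<tau>" "\<xi> \<in> closure \<Omega>" "\<zeta> \<in> closure \<Omega>"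
  shows "dist (X s \<tau> \<xi>) (X s \<tau> \<zeta>) \<le> exp (L * \<bar>s - \<tau>\<bar>) * dist \<xi> \<zeta>"
  using trajectories_dist[of L "closure \<Omega>" v "\<lambda>r. X r \<tau> \<xi>" "\<lambda>r. X r \<tau> \<zeta>" \<tau> s] assms
  unfolding is_flow_def by auto

text \<open>Both trajectories pass through \<open>X s \<tau> \<xi>\<close> at time s, so
  \<open>trajectories_dist\<close> identifies them. This provides the inverse of the flow
  map.\<close>

lemma flow_cancel:
  assumes flow: "is_flow \<Omega> v X" and lip: "\<And>s. 0 \<le> s \<Longrightarrow> L-lipschitz_on (closure \<Omega>) (v s)"
    and "0 \<le> s" "0 \<le> \<tau>" "\<xi> \<in> closure \<Omega>"
  shows "X \<tau> s (X s \<tau> \<xi>) = \<xi>"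
proof -
  have "X s \<tau> \<xi> \<in> closure \<Omega>" using assms unfolding is_flow_def by auto
  then have "dist (X \<tau> s (X s \<tau> \<xi>)) (X \<tau> \<tau> \<xi>) \<le>
      exp (L * \<bar>\<tau> - s\<bar>) * dist (X s s (X s \<tau> \<xi>)) (X s \<tau> \<xi>)"
    using trajectories_dist[of L "closure \<Omega>" v "\<lambda>r. X r s (X s \<tau> \<xi>)" "\<lambda>r. X r \<tau> \<xi>" s \<tau>]
      lip flow \<open>0 \<le> s\<close> \<open>0 \<le> \<tau>\<close> \<open>\<xi> \<in> closure \<Omega>\<close> unfolding is_flow_def by auto
  also have "\<dots> = 0" using \<open>X s \<tau> \<xi> \<in> closure \<Omega>\<close> flow \<open>0 \<le> s\<close> by (simp add: is_flow_def)
  finally show ?thesis using flow \<open>0 \<le> \<tau>\<close> \<open>\<xi> \<in> closure \<Omega>\<close> by (simp add: is_flow_def)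
qed

lemma continuous_on_flow:
  assumes "is_flow \<Omega> v X" "\<And>s. 0 \<le> s \<Longrightarrow> L-lipschitz_on (closure \<Omega>) (v s)" "0 \<le> s" "0 \<le> \<tau>"
  shows "continuous_on (closure \<Omega>) (X s \<tau>)"
  by (rule lipschitz_on_continuous_on[where L="exp (L * \<bar>s - \<tau>\<bar>)"], rule lipschitz_onI)
     (use flow_dist[OF assms] in auto)

text \<open>A nearest point of \<open>B\<close> is exchanged for a point of \<open>A\<close> at cost
  e. The bound is one-sided, so a Lipschitz estimate takes two applications.\<close>

lemma infdist_moving:
  fixes A B :: "'a::heine_borel set"
  assumes "closed B" "B \<noteq> {}" and AB: "\<And>b. b \<in> B \<Longrightarrow> \<exists>a\<in>A. dist a b \<le> e"
  shows "infdist x A \<le> infdist y B + dist x y + e"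
proof -
  obtain b where b: "b \<in> B" "infdist y B = dist y b"
    using infdist_attains_inf[OF assms(1,2)] by metis
  obtain a where a: "a \<in> A" "dist a b \<le> e" using AB[OF b(1)] by blast
  have "infdist x A \<le> dist x a" by (rule infdist_le[OF a(1)])
  also have "\<dots> \<le> dist y b + dist x y + e" using a(2)
    by (metis add.commute add_mono dist_commute dist_triangle dist_triangle_le order_refl)
  finally show ?thesis using b by simp
qed

text \<open>On a bounded time interval the velocity is bounded by compactness, so the image of
  \<open>S\<close> moves with bounded speed and its distance function is Lipschitz in time and
  space. Bounds on that distance then define closed or open sets in space-time.\<close>

lemma infdist_flow_image_continuous:
  assumes flow: "is_flow \<Omega> v X" and lip: "\<And>s. 0 \<le> s \<Longrightarrow> L-lipschitz_on (closure \<Omega>) (v s)"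
    and cont: "continuous_on ({0..} \<times> closure \<Omega>) (\<lambda>(t, x). v t x)" and "bounded \<Omega>"
    and S: "compact S" "S \<noteq> {}" "S \<subseteq> closure \<Omega>"
  shows "continuous_on ({0..T} \<times> UNIV) (\<lambda>z. infdist (snd z) (X (fst z) 0 ` S))"
proof -
  have "compact ({0..T} \<times> closure \<Omega>)" using \<open>bounded \<Omega>\<close> by (simp add: compact_Times)
  moreover have "continuous_on ({0..T} \<times> closure \<Omega>) (\<lambda>(t, x). v t x)"
    using cont by (rule continuous_on_subset) auto
  ultimately have "bounded ((\<lambda>(t, x). v t x) ` ({0..T} \<times> closure \<Omega>))"
    by (intro compact_imp_bounded compact_continuous_image)
  then obtain M where M: "0 < M" "\<And>t x. t \<in> {0..T} \<Longrightarrow> x \<in> closure \<Omega> \<Longrightarrow> norm (v t x) \<le> M"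
    unfolding bounded_pos by force
  have speed: "dist (X a 0 \<xi>) (X b 0 \<xi>) \<le> M * \<bar>a - b\<bar>"
    if "a \<in> {0..T}" "b \<in> {0..T}" "\<xi> \<in> S" for a b \<xi>
    by (rule trajectory_speed[where y="\<lambda>r. X r 0 \<xi>" and y'="\<lambda>r. v r (X r 0 \<xi>)" and T=T])
       (use flow S that M in \<open>auto simp: is_flow_def subset_iff\<close>)
  have closed: "closed (X t 0 ` S)" if "0 \<le> t" for t
    using continuous_on_subset[OF continuous_on_flow[OF flow lip that order_refl] S(3)] S(1)
    by (intro compact_imp_closed compact_continuous_image)
  have le: "infdist x (X t 0 ` S) \<le> infdist y (X s 0 ` S) + dist x y + M * \<bar>t - s\<bar>"
    if "t \<in> {0..T}" "s \<in> {0..T}" for x y t s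
  proof (rule infdist_moving)
    fix b assume "b \<in> X s 0 ` S"
    then obtain \<xi> where "\<xi> \<in> S" "b = X s 0 \<xi>" by blast
    then show "\<exists>a\<in>X t 0 ` S. dist a b \<le> M * \<bar>t - s\<bar>" using speed[OF that] by blast
  qed (use closed S that in auto)
  show ?thesis
  proof (rule lipschitz_on_continuous_on, rule lipschitz_onI)
    fix z z' :: "real \<times> (real^3)" assume z: "z \<in> {0..T} \<times> UNIV" "z' \<in> {0..T} \<times> UNIV"
    have "\<bar>infdist (snd z) (X (fst z) 0 ` S) - infdist (snd z') (X (fst z') 0 ` S)\<bar> \<le>
        dist (snd z) (snd z') + M * \<bar>fst z - fst z'\<bar>"
      using le[of "fst z" "fst z'" "snd z" "snd z'"] le[of "fst z'" "fst z" "snd z'" "snd z"] z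
      by (auto simp: dist_commute abs_minus_commute abs_le_iff)
    also have "\<dots> \<le> dist z z' + M * dist z z'"
      using M(1) dist_snd_le[of z z'] dist_fst_le[of z z']
      by (intro add_mono mult_left_mono) (auto simp: dist_real_def)
    finally show "dist (infdist (snd z) (X (fst z) 0 ` S)) (infdist (snd z') (X (fst z') 0 ` S)) \<le>
        (1 + M) * dist z z'" by (simp add: dist_real_def algebra_simps)
  qed (use M in simp)
qed

lemma nonneg_at_closure:
  fixes f :: "'a::topological_space \<Rightarrow> real"
  assumes "open G" "continuous_on G f" "x \<in> G" "x \<in> closure B"
    and "\<And>y. y \<in> B \<Longrightarrow> y \<in> G \<Longrightarrow> 0 \<le> f y"
  shows "0 \<le> f x"
proof (rule ccontr)
  assume "\<not> 0 \<le> f x"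
  define W where "W = f -` {..<0} \<inter> G"
  have "open W" unfolding W_def using assms(1,2) by (simp add: continuous_on_open_vimage)
  have "x \<in> W" using \<open>\<not> 0 \<le> f x\<close> assms(3) by (simp add: W_def)
  then have "W \<inter> closure B \<noteq> {}" using assms(4) by blast
  then have "W \<inter> B \<noteq> {}" using open_Int_closure_eq_empty[OF \<open>open W\<close>, of B] by simp
  then obtain y where "y \<in> B" "y \<in> G" "f y < 0" by (auto simp: W_def)
  then show False using assms(5)[of y] by simp
qed

lemma compact_pos_lower_bound:
  fixes f :: "'a::topological_space \<Rightarrow> real"
  assumes "compact P" "continuous_on P f" "\<And>x. x \<in> P \<Longrightarrow> 0 < f x"
  obtains \<delta> where "0 < \<delta>" "\<And>x. x \<in> P \<Longrightarrow> \<delta> \<le> f x"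
proof (cases "P = {}")
  case False
  with continuous_attains_inf[OF assms(1) _ assms(2)] obtain x
    where "x \<in> P" "\<forall>y\<in>P. f x \<le> f y" by blast
  then show ?thesis using that[of "f x"] assms(3) by blast
qed (use that[of 1] in simp)

text \<open>Compactness supplies a nearest point; nonemptiness matters because
  \<open>infdist\<close> to the empty set is 0.\<close>

lemma eps_nbhd_iff_infdist:
  fixes S :: "'a::heine_borel set"
  assumes "compact S" "S \<noteq> {}"
  shows "x \<in> eps_nbhd S e \<longleftrightarrow> infdist x S < e"
proof
  assume "x \<in> eps_nbhd S e"
  then obtain s where "s \<in> S" "dist x s < e" by (auto simp: eps_nbhd_def dist_commute)
  then show "infdist x S < e" using infdist_le[of s S x] by simp
next
  assume "infdist x S < e"
  moreover obtain s where "s \<in> S" "infdist x S = dist x s"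
    using infdist_attains_inf[OF compact_imp_closed[OF assms(1)] assms(2)] by metis
  ultimately show "x \<in> eps_nbhd S e" by (auto simp: eps_nbhd_def dist_commute)
qed

subsection \<open>Coincidence near the surface\<close>

theorem theorem2p9:
  fixes \<Omega> \<Omega>p0 \<Omega>m0 \<Sigma>0 :: "(real^3) set"
    and v w :: "real \<Rightarrow> real^3 \<Rightarrow> real^3"
    and X :: "real \<Rightarrow> real \<Rightarrow> real^3 \<Rightarrow> real^3"
    and \<Omega>p \<Omega>m \<Sigma> :: "real \<Rightarrow> (real^3) set"
    and \<phi>\<^sub>0 :: "real^3 \<Rightarrow> real"
    and \<epsilon>\<^sub>0 r\<^sub>0 :: real
    and \<eta> :: "real \<Rightarrow> real"
    and \<Theta> :: "(real \<times> (real^3)) set"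
    and \<phi> \<psi> :: "real \<times> (real^3) \<Rightarrow> real"
  assumes dom: "open \<Omega>" "connected \<Omega>" "bounded \<Omega>"
    and H1: "hyp_H1 \<Omega> v" and H2: "hyp_H2 \<Omega> v"
    and flow: "is_flow \<Omega> v X"
    and ext: "is_extension \<Omega> v w"
    and subdomain: "open \<Omega>p0" "connected \<Omega>p0" "\<Omega>p0 \<noteq> {}" "\<Omega>p0 \<subseteq> \<Omega>"
    and \<Sigma>0_def: "\<Sigma>0 = frontier \<Omega>p0"
    and surface: "closed_C2_surface \<Sigma>0" "\<Sigma>0 \<inter> frontier \<Omega> = {}"
    and \<Omega>m0_def: "\<Omega>m0 = \<Omega> - (\<Omega>p0 \<union> \<Sigma>0)"
    and \<Omega>p_def: "\<Omega>p = (\<lambda>t. X t 0 ` \<Omega>p0)"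
    and \<Omega>m_def: "\<Omega>m = (\<lambda>t. X t 0 ` \<Omega>m0)"
    and \<Sigma>_def: "\<Sigma> = (\<lambda>t. X t 0 ` \<Sigma>0)"
    and init: "continuous_on (closure \<Omega>) \<phi>\<^sub>0"
      "\<forall>x\<in>frontier \<Omega>. \<phi>\<^sub>0 x = 0"
      "\<forall>x\<in>\<Omega>p0. \<phi>\<^sub>0 x > 0"
      "\<forall>x\<in>\<Omega>m0. \<phi>\<^sub>0 x < 0"
      "{x\<in>\<Omega>. \<phi>\<^sub>0 x = 0} = \<Sigma>0"
      "\<forall>x\<in>\<Sigma>0. grad \<phi>\<^sub>0 x \<noteq> 0"
      "\<exists>U. open U \<and> \<Sigma>0 \<subseteq> U \<and> C2_on U \<phi>\<^sub>0"
    and eps0: "\<epsilon>\<^sub>0 > 0" "eps_nbhd \<Sigma>0 \<epsilon>\<^sub>0 \<subseteq> \<Omega>" "C2_on (eps_nbhd \<Sigma>0 \<epsilon>\<^sub>0) \<phi>\<^sub>0"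
      "(INF \<xi>\<in>eps_nbhd \<Sigma>0 \<epsilon>\<^sub>0. norm (grad \<phi>\<^sub>0 \<xi>)) > 0"
    and cut: "cutoff r\<^sub>0 \<eta>"
    and r0: "0 < r\<^sub>0" "r\<^sub>0 < 1"
      "sqrt r\<^sub>0 \<le> 1/2 * (INF \<xi>\<in>eps_nbhd \<Sigma>0 \<epsilon>\<^sub>0. norm (grad \<phi>\<^sub>0 \<xi>))"
    and tube: "tubular_nbhd \<Omega> \<Sigma> \<Theta>" "\<forall>x. (0, x) \<in> \<Theta> \<longrightarrow> x \<in> eps_nbhd \<Sigma>0 \<epsilon>\<^sub>0"
    and phi: "C2_on \<Theta> \<phi>"
      "solves_on_tube \<Omega> v \<Theta> \<phi>"
      "\<forall>x. (0, x) \<in> \<Theta> \<longrightarrow> \<phi> (0, x) = \<phi>\<^sub>0 x"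
      "\<forall>t\<ge>0. \<forall>x\<in>\<Omega>p t. (t, x) \<in> \<Theta> \<longrightarrow> \<phi> (t, x) > 0"
      "\<forall>t\<ge>0. \<forall>x\<in>\<Omega>m t. (t, x) \<in> \<Theta> \<longrightarrow> \<phi> (t, x) < 0"
      "\<forall>(t, x)\<in>\<Theta>. \<exists>\<xi>. (0, \<xi>) \<in> \<Theta> \<and>
         norm (grad (\<lambda>y. \<phi> (t, y)) x) = norm (grad \<phi>\<^sub>0 \<xi>) \<and> norm (grad \<phi>\<^sub>0 \<xi>) \<noteq> 0"
    and psi: "solves_viscosity_problem \<Omega> w \<eta> \<phi>\<^sub>0 \<psi>"
      "\<forall>t\<ge>0. \<forall>x\<in>\<Omega>p t. \<psi> (t, x) > 0"
      "\<forall>t\<ge>0. \<forall>x\<in>\<Omega>m t. \<psi> (t, x) < 0"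
      "\<forall>t\<ge>0. \<forall>x\<in>\<Sigma> t. \<psi> (t, x) = 0"
  shows "\<exists>\<Theta>'. tubular_nbhd \<Omega> \<Sigma> \<Theta>' \<and> \<Theta>' \<subseteq> \<Theta> \<and> (\<forall>z\<in>\<Theta>'. \<phi> z = \<psi> z)"
proof -

  \<comment> \<open>Constants, continuity and compactness from the hypotheses\<close>
  obtain L\<^sub>v where lip_v: "\<And>s. 0 \<le> s \<Longrightarrow> L\<^sub>v-lipschitz_on (closure \<Omega>) (v s)"
    using H1 unfolding hyp_H1_def by blast
  have cont_v: "continuous_on ({0..} \<times> closure \<Omega>) (\<lambda>(t, x). v t x)"
    using H1 unfolding hyp_H1_def by blast
  obtain L where lip_w: "\<And>s. 0 \<le> s \<Longrightarrow> L-lipschitz_on UNIV (w s)"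
    using ext unfolding is_extension_def by blast
  have "0 \<le> L" using lipschitz_on_nonneg[OF lip_w[of 0]] by simp
  have w_eq: "w t x = v t x" if "0 \<le> t" "x \<in> closure \<Omega>" for t x
    using ext that unfolding is_extension_def by blast
  have "bounded \<Omega>p0" using \<open>bounded \<Omega>\<close> subdomain(4) by (rule bounded_subset)
  then have \<Sigma>0: "compact \<Sigma>0" "\<Sigma>0 \<noteq> {}" "\<Sigma>0 \<subseteq> closure \<Omega>p0"
    using subdomain(3) frontier_eq_empty[of \<Omega>p0] not_bounded_UNIV
    by (auto simp: \<Sigma>0_def compact_frontier_bounded closure_Un_frontier)
  have \<Sigma>0_\<Omega>: "\<Sigma>0 \<subseteq> \<Omega>" using init(5) by blast
  have \<Omega>_cl: "\<Omega> \<subseteq> closure \<Omega>" by (rule closure_subset)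
  have cont_X: "continuous_on (closure \<Omega>) (X t 0)" if "0 \<le> t" for t
    using continuous_on_flow[OF flow lip_v that] by simp
  have \<Sigma>: "compact (\<Sigma> t)" "\<Sigma> t \<noteq> {}" if "0 \<le> t" for t
    using continuous_on_subset[OF cont_X[OF that], of \<Sigma>0] \<Sigma>0 \<Sigma>0_\<Omega> \<Omega>_cl
    by (auto simp: \<Sigma>_def intro!: compact_continuous_image)
  have \<Theta>_\<Omega>: "\<Theta> \<subseteq> {0..} \<times> \<Omega>" and \<Sigma>_\<Theta>: "\<And>t x. 0 \<le> t \<Longrightarrow> x \<in> \<Sigma> t \<Longrightarrow> (t, x) \<in> \<Theta>"
    and open_\<Theta>: "\<And>t. 0 \<le> t \<Longrightarrow> open {x \<in> \<Omega>. (t, x) \<in> \<Theta>}"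
    using tube(1) unfolding tubular_nbhd_def by blast+
  obtain \<epsilon> where \<epsilon>: "\<And>t. 0 \<le> t \<Longrightarrow> 0 < \<epsilon> t" "antimono_on {0..} \<epsilon>"
    "\<And>t. 0 \<le> t \<Longrightarrow> {t} \<times> eps_nbhd (\<Sigma> t) (\<epsilon> t) \<subseteq> \<Theta>"
    using tube(1) unfolding tubular_nbhd_def by blast
  have C1_\<phi>: "C1_on \<Theta> \<phi>" using phi(1) by (rule C2_on_imp_C1_on)
  then have cont_\<phi>: "continuous_on \<Theta> \<phi>" by (rule C1_on_imp_continuous_on)
  have cont_\<psi>: "continuous_on ({0..} \<times> closure \<Omega>) \<psi>"
    using psi(1) unfolding solves_viscosity_problem_def by blast

  \<comment> \<open>The zero set of \<open>\<phi>\<close> near the moving surface\<close>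
  have \<Sigma>0_m: "\<Sigma>0 \<subseteq> closure \<Omega>m0"
  proof
    fix \<xi> assume \<xi>: "\<xi> \<in> \<Sigma>0"
    show "\<xi> \<in> closure \<Omega>m0"
    proof (rule ccontr)
      assume "\<xi> \<notin> closure \<Omega>m0"
      \<comment> \<open>On \<open>N\<close> the function \<open>\<phi>\<^sub>0\<close> is
        nonnegative, so its zero at \<open>\<xi>\<close> would be a minimum, against the nonzero
        gradient. Hence the negative phase also reaches every surface point.\<close>
      define N where "N = \<Omega> - closure \<Omega>m0"
      have "open N" unfolding N_def using \<open>open \<Omega>\<close> by (intro open_Diff) auto
      have "\<xi> \<in> N" using \<xi> \<Sigma>0_\<Omega> \<open>\<xi> \<notin> closure \<Omega>m0\<close> by (auto simp: N_def)
      have "\<phi>\<^sub>0 \<xi> = 0" using \<xi> init(5) by blast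
      have "0 \<le> \<phi>\<^sub>0 x" if "x \<in> N" for x
      proof -
        have "x \<in> \<Omega>" "x \<notin> \<Omega>m0" using that closure_subset by (auto simp: N_def)
        then have "x \<in> \<Omega>p0 \<or> \<phi>\<^sub>0 x = 0" using \<Omega>m0_def init(5) by blast
        then show ?thesis using init(3) by force
      qed
      moreover obtain D where "(\<phi>\<^sub>0 has_derivative D) (at \<xi>)"
      proof -
        obtain U where U: "open U" "\<Sigma>0 \<subseteq> U" "C2_on U \<phi>\<^sub>0" using init(7) by blast
        then obtain E where "(\<phi>\<^sub>0 has_derivative E) (at \<xi> within U)"
          using \<xi> unfolding C2_on_def by blast
        then show ?thesis using that U \<xi> by (metis at_within_open subsetD)
      qed
      ultimately have "(\<phi>\<^sub>0 has_derivative (\<lambda>_. 0)) (at \<xi>)"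
        using differential_zero_maxmin[OF \<open>\<xi> \<in> N\<close> \<open>open N\<close>] \<open>\<phi>\<^sub>0 \<xi> = 0\<close> by metis
      then have "GDERIV \<phi>\<^sub>0 \<xi> :> 0" by (simp add: gderiv_def)
      then show False using grad_eqI init(6) \<xi> by blast
    qed
  qed
  have X_closure: "X t 0 \<xi> \<in> closure (X t 0 ` A)"
    if "0 \<le> t" "A \<subseteq> \<Omega>" "\<xi> \<in> closure A" for t A \<xi>
  proof -
    have "X t 0 ` closure A \<subseteq> closure (X t 0 ` A)"
      using continuous_on_subset[OF cont_X[OF that(1)] closure_mono[OF that(2)]]
      by (rule image_closure_subset) (simp_all add: closure_subset)
    then show ?thesis using that(3) by blast
  qed
  \<comment> \<open>By continuity of the flow every surface point is a limit of both phases, and the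
    two sign conditions leave only the value 0.\<close>
  have \<phi>_zero: "\<phi> (t, x) = 0" if t: "0 \<le> t" and x: "x \<in> \<Sigma> t" for t x
  proof -
    obtain \<xi> where \<xi>: "\<xi> \<in> \<Sigma>0" "x = X t 0 \<xi>" using x by (auto simp: \<Sigma>_def)
    define G where "G = {x \<in> \<Omega>. (t, x) \<in> \<Theta>}"
    have G: "open G" "x \<in> G" using open_\<Theta>[OF t] \<Sigma>_\<Theta>[OF t x] \<Theta>_\<Omega> by (auto simp: G_def)
    have cont: "continuous_on G (\<lambda>y. \<phi> (t, y))"
      by (rule continuous_on_compose2[OF cont_\<phi>]) (auto simp: G_def intro!: continuous_intros)
    have "\<Omega>m0 \<subseteq> \<Omega>" by (auto simp: \<Omega>m0_def)
    then have "x \<in> closure (\<Omega>p t)" "x \<in> closure (\<Omega>m t)"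
      using X_closure[OF t] \<xi> \<Sigma>0(3) \<Sigma>0_m subdomain(4) by (auto simp: \<Omega>p_def \<Omega>m_def)
    moreover have "0 \<le> \<phi> (t, y)" if "y \<in> \<Omega>p t" "y \<in> G" for y
      using phi(4) t that by (force simp: G_def)
    moreover have "0 \<le> - \<phi> (t, y)" if "y \<in> \<Omega>m t" "y \<in> G" for y
      using phi(5) t that by (force simp: G_def)
    ultimately have "0 \<le> \<phi> (t, x)" "0 \<le> - \<phi> (t, x)"
      using nonneg_at_closure[OF G(1) cont G(2)]
        nonneg_at_closure[OF G(1) continuous_on_minus[OF cont] G(2)] by blast+
    then show ?thesis by simp
  qed
  \<comment> \<open>Points close to the surface stay inside \<open>\<Omega>\<close> under the backward flow,
    by its Lipschitz dependence on the data.\<close>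
  have \<phi>_nonzero: "\<phi> (t, x) \<noteq> 0"
    if t: "0 \<le> t" "(t, x) \<in> \<Theta>" "x \<notin> \<Sigma> t" and d: "exp (L\<^sub>v * t) * infdist x (\<Sigma> t) < \<epsilon>\<^sub>0" for t x
  proof -
    have x: "x \<in> closure \<Omega>" using t(2) \<Theta>_\<Omega> \<Omega>_cl by auto
    obtain y where "y \<in> \<Sigma> t" and y: "infdist x (\<Sigma> t) = dist x y"
      using infdist_attains_inf[OF compact_imp_closed[OF \<Sigma>(1)] \<Sigma>(2)] t(1) by metis
    then obtain \<zeta> where \<zeta>: "\<zeta> \<in> \<Sigma>0" "y = X t 0 \<zeta>" by (auto simp: \<Sigma>_def)
    have \<zeta>_cl: "\<zeta> \<in> closure \<Omega>" using \<zeta>(1) \<Sigma>0_\<Omega> \<Omega>_cl by blast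
    have "y \<in> closure \<Omega>" using \<zeta>(2) \<zeta>_cl flow t(1) by (auto simp: is_flow_def)
    from flow_dist[OF flow lip_v order_refl t(1) x this]
    have "dist (X 0 t x) (X 0 t y) \<le> exp (L\<^sub>v * t) * dist x y" using t(1) by simp
    then have "dist (X 0 t x) \<zeta> < \<epsilon>\<^sub>0"
      using d y flow_cancel[OF flow lip_v t(1) order_refl \<zeta>_cl] \<zeta>(2) by simp
    then have "X 0 t x \<in> eps_nbhd \<Sigma>0 \<epsilon>\<^sub>0" using \<zeta>(1) by (auto simp: eps_nbhd_def dist_commute)
    then have "X 0 t x \<in> \<Omega>" using eps0(2) by blast
    moreover have X: "X t 0 (X 0 t x) = x"
      using flow_cancel[OF flow lip_v order_refl t(1) x] .
    moreover have "X 0 t x \<notin> \<Sigma>0" using X t(3) unfolding \<Sigma>_def by (metis imageI)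
    ultimately have "x \<in> \<Omega>p t \<or> x \<in> \<Omega>m t"
      unfolding \<Omega>p_def \<Omega>m_def \<Omega>m0_def by (metis DiffI UnE imageI)
    then show ?thesis using phi(4,5) t by fastforce
  qed

  \<comment> \<open>Viscosity inequalities for \<open>\<psi>\<close> and its negative\<close>
  define U :: "(real \<times> (real^3)) set" where "U = {0<..} \<times> \<Omega>"
  have "open U" unfolding U_def using \<open>open \<Omega>\<close> by (intro open_Times) auto
  have visc: "viscosity_solution U (hamiltonian w \<eta>) \<psi>"
    using psi(1) unfolding solves_viscosity_problem_def U_def by blast
  have cont_U: "continuous_on U \<psi>"
    using cont_\<psi> by (rule continuous_on_subset) (use \<Omega>_cl in \<open>auto simp: U_def\<close>)
  have sub: "hamiltonian w \<eta> z (\<psi> z) (grad f z) \<le> 0"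
    if "C1_on U f" "z \<in> U" "local_max_at U (\<lambda>y. \<psi> y - f y) z" for f z
  proof -
    have "local_max_at U (\<lambda>y. usc_envelope U \<psi> y - f y) z"
      using that usc_envelope_continuous[OF cont_U] unfolding local_max_at_def by simp
    then show ?thesis
      using visc that(1,2) usc_envelope_continuous[OF cont_U that(2)]
      unfolding viscosity_solution_def viscosity_subsolution_def by metis
  qed
  \<comment> \<open>The Hamiltonian is odd in the pair of value and gradient, so the supersolution
    condition for \<open>\<psi>\<close> is the subsolution condition for its negative. A single
    comparison lemma then gives both inequalities.\<close>
  have sub_minus: "hamiltonian w \<eta> z (- \<psi> z) (grad f z) \<le> 0"
    if f: "C1_on U f" and z: "z \<in> U" and max: "local_max_at U (\<lambda>y. - \<psi> y - f y) z" for f z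
  proof -
    obtain r where r: "0 < r" "\<forall>y\<in>U \<inter> ball z r. - \<psi> y - f y \<le> - \<psi> z - f z"
      using max unfolding local_max_at_def by blast
    have "lsc_envelope U \<psi> z - - f z \<le> lsc_envelope U \<psi> y - - f y" if y: "y \<in> U \<inter> ball z r" for y
    proof -
      have "lsc_envelope U \<psi> y = \<psi> y" "lsc_envelope U \<psi> z = \<psi> z"
        using y z lsc_envelope_continuous[OF cont_U] by auto
      moreover have "- \<psi> y - f y \<le> - \<psi> z - f z" using r(2) y by blast
      ultimately show ?thesis by simp
    qed
    then have "local_min_at U (\<lambda>y. lsc_envelope U \<psi> y - - f y) z"
      unfolding local_min_at_def using \<open>0 < r\<close> by blast
    then have ge: "0 \<le> hamiltonian w \<eta> z (\<psi> z) (grad (\<lambda>y. - f y) z)"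
      using visc z C1_on_uminus[OF f] lsc_envelope_continuous[OF cont_U z]
      unfolding viscosity_solution_def viscosity_supersolution_def by metis
    obtain D where "(f has_derivative D) (at z)"
      using f z \<open>open U\<close> unfolding C1_on_def by (metis at_within_open)
    then have g: "GDERIV f z :> (\<Sum>b\<in>Basis. D b *\<^sub>R b)" by (rule GDERIV_of_has_derivative)
    have "grad (\<lambda>y. - f y) z = - grad f z"
      using grad_eqI[OF g] grad_eqI[OF GDERIV_minus[OF g]] by simp
    then show ?thesis using ge by (simp add: hamiltonian_def)
  qed

  \<comment> \<open>Gradient bound and classical equation at interior points of the tube\<close>
  define m where "m = (INF \<xi>\<in>eps_nbhd \<Sigma>0 \<epsilon>\<^sub>0. norm (grad \<phi>\<^sub>0 \<xi>))"
  have m: "m \<le> norm (grad \<phi>\<^sub>0 \<xi>)" if "(0, \<xi>) \<in> \<Theta>" for \<xi>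
    unfolding m_def by (rule cINF_lower) (use tube(2) that in \<open>auto intro: bdd_belowI[where m=0]\<close>)
  have "(2 * sqrt r\<^sub>0)\<^sup>2 \<le> m\<^sup>2"
    using r0 by (intro power_mono) (auto simp: m_def)
  then have r0_m: "4 * r\<^sub>0 \<le> m\<^sup>2" using r0(1) by (simp add: power_mult_distrib)
  have "0 < m" using eps0(4) by (simp add: m_def)
  \<comment> \<open>Derivatives are taken within \<open>\<Theta>\<close> or its sections, which need
    not be open in time; at interior points they are full derivatives. The spatial gradient has the
    norm of an initial one, hence at least \<open>m\<close>, and the argument of \<open>v\<close>
    lies where \<open>w\<close> agrees with \<open>v\<close>.\<close>
  have pde: "\<exists>q p. GDERIV \<phi> (t, x) :> (q, p) \<and> p \<noteq> 0 \<and> 4 * r\<^sub>0 \<le> (norm p)\<^sup>2 \<and>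
      q + w t (x - (\<phi> (t, x) / (norm p)\<^sup>2) *\<^sub>R p) \<bullet> p = 0"
    if z: "(t, x) \<in> interior \<Theta>" and "0 < t" for t x
  proof -
    have z\<Theta>: "(t, x) \<in> \<Theta>" using z interior_subset by blast
    obtain D where "(\<phi> has_derivative D) (at (t, x) within \<Theta>)"
      using C1_\<phi> z\<Theta> unfolding C1_on_def by blast
    then have "(\<phi> has_derivative D) (at (t, x))" by (simp only: at_within_interior[OF z])
    note D = GDERIV_of_has_derivative[OF this]
    obtain q p where "(\<Sum>b\<in>Basis. D b *\<^sub>R b) = (q, p)" by (rule prod.exhaust)
    with D have qp: "GDERIV \<phi> (t, x) :> (q, p)" by simp
    then have der: "(\<phi> has_derivative (\<lambda>h. h \<bullet> (q, p))) (at (t, x))" by (simp add: gderiv_def)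
    have "((\<lambda>y. \<phi> (t, y)) has_derivative (\<lambda>h. (0, h) \<bullet> (q, p))) (at x)"
      by (rule has_derivative_compose[of "Pair t", OF _ der]) (auto intro!: derivative_eq_intros)
    then have "GDERIV (\<lambda>y. \<phi> (t, y)) x :> p" by (simp add: gderiv_def)
    note grad = grad_eqI[OF this]
    have "((\<lambda>s. \<phi> (s, x)) has_derivative (\<lambda>h. (h, 0) \<bullet> (q, p))) (at t)"
      by (rule has_derivative_compose[of "\<lambda>s. (s, x)", OF _ der]) (auto intro!: derivative_eq_intros)
    then have q: "((\<lambda>s. \<phi> (s, x)) has_real_derivative q) (at t)"
      by (simp add: has_field_derivative_def mult_commute_abs)
    have "t \<in> interior {s. (s, x) \<in> \<Theta>}"
    proof -
      have "open ((\<lambda>s. (s, x)) -` interior \<Theta>)"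
        by (intro open_vimage open_interior continuous_intros)
      then show ?thesis
        by (rule interiorI) (use z interior_subset[of \<Theta>] in auto)
    qed
    note at = at_within_interior[OF this]
    obtain q' where y: "x - (\<phi> (t, x) / (norm p)\<^sup>2) *\<^sub>R p \<in> closure \<Omega>"
      and q': "((\<lambda>s. \<phi> (s, x)) has_real_derivative q') (at t)"
      "q' + v t (x - (\<phi> (t, x) / (norm p)\<^sup>2) *\<^sub>R p) \<bullet> p = 0"
      using phi(2) z\<Theta> \<open>0 < t\<close> unfolding solves_on_tube_def Let_def
      by (fastforce simp: grad at)
    have "q' = q" using DERIV_unique[OF q'(1) q] .
    obtain \<xi> where \<xi>: "(0, \<xi>) \<in> \<Theta>" "norm p = norm (grad \<phi>\<^sub>0 \<xi>)"
      using phi(6) z\<Theta> grad by force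
    then have "m \<le> norm p" using m by simp
    then have "m\<^sup>2 \<le> (norm p)\<^sup>2" using \<open>0 < m\<close> by (intro power_mono) auto
    then have "4 * r\<^sub>0 \<le> (norm p)\<^sup>2" using r0_m by linarith
    moreover have "p \<noteq> 0" using \<open>m \<le> norm p\<close> \<open>0 < m\<close> by auto
    ultimately show ?thesis
      using qp q'(2) y w_eq \<open>0 < t\<close> \<open>q' = q\<close> by (metis less_imp_le)
  qed

  \<comment> \<open>Coincidence on bounded time intervals\<close>
  have loc: "\<exists>\<rho>\<in>{0<..1}. \<forall>t\<in>{0..T\<^sub>0}. \<forall>x\<in>eps_nbhd (\<Sigma> t) \<rho>. (t, x) \<in> \<Theta> \<and> \<phi> (t, x) = \<psi> (t, x)"
    if "0 \<le> T\<^sub>0" for T\<^sub>0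
  proof -
    \<comment> \<open>The comparison holds only strictly before its final time, so that time is
      placed beyond \<open>T\<^sub>0\<close>.\<close>
    define T where "T = T\<^sub>0 + 1"
    have T: "0 \<le> T" "T\<^sub>0 < T" using that by (auto simp: T_def)
    define d where "d z = infdist (snd z) (\<Sigma> (fst z))" for z :: "real \<times> (real^3)"
    have cont_d: "continuous_on ({0..T} \<times> UNIV) d"
      using infdist_flow_image_continuous[OF flow lip_v cont_v \<open>bounded \<Omega>\<close> \<Sigma>0(1,2)] \<Sigma>0_\<Omega> \<Omega>_cl
      unfolding d_def \<Sigma>_def by blast
    \<comment> \<open>The bound 1 keeps the later supremum finite. The second one puts the closed
      tube into \<open>\<Theta>\<close> for all times up to T, as \<open>\<epsilon>\<close> is
      nonincreasing. The third one makes \<open>\<phi>_nonzero\<close> applicable, its exponential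
      offsetting the expansion under the backward flow.\<close>
    define \<rho> where "\<rho> = min 1 (min (\<epsilon> T / 2) (\<epsilon>\<^sub>0 / 2 * exp (- (\<bar>L\<^sub>v\<bar> * T))))"
    have \<rho>: "0 < \<rho>" "\<rho> \<le> 1" "\<rho> < \<epsilon> T" "\<rho> \<le> \<epsilon>\<^sub>0 / 2 * exp (- (\<bar>L\<^sub>v\<bar> * T))"
      using \<epsilon>(1)[OF T(1)] eps0(1) by (auto simp: \<rho>_def)
    define Q where "Q = {z \<in> {0..T} \<times> UNIV. d z \<le> \<rho>}"
    have Q\<Theta>: "Q \<subseteq> \<Theta>"
    proof
      fix z assume "z \<in> Q"
      then have z: "fst z \<in> {0..T}" "d z \<le> \<rho>" by (auto simp: Q_def)
      have "\<epsilon> T \<le> \<epsilon> (fst z)" using \<epsilon>(2) z(1) T by (auto simp: monotone_on_def)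
      then have "snd z \<in> eps_nbhd (\<Sigma> (fst z)) (\<epsilon> (fst z))"
        using z \<rho>(3) eps_nbhd_iff_infdist[OF \<Sigma>] by (simp add: d_def)
      then have "(fst z, snd z) \<in> \<Theta>" using \<epsilon>(3)[of "fst z"] z(1) by auto
      then show "z \<in> \<Theta>" by simp
    qed
    have closed_Q: "closed {z \<in> {0..T} \<times> UNIV. d z \<in> I}" if "closed I" for I
      using continuous_closed_preimage[OF cont_d _ that]
      by (simp add: vimage_def Int_def closed_Times)
    have "closed Q" using closed_Q[of "{..\<rho>}"] by (simp add: Q_def)
    moreover have "bounded Q"
      by (rule bounded_subset[OF bounded_Times[OF bounded_closed_interval \<open>bounded \<Omega>\<close>]])
         (use Q\<Theta> \<Theta>_\<Omega> in \<open>auto simp: Q_def\<close>)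
    ultimately have "compact Q" by (simp add: compact_eq_bounded_closed)
    have Q_sub: "Q \<subseteq> {0..T} \<times> \<Omega>" using Q\<Theta> \<Theta>_\<Omega> by (auto simp: Q_def)
    then have int_U: "interior Q \<subseteq> U"
      using interior_mono[OF Q_sub] by (auto simp: interior_Times U_def interior_open \<open>open \<Omega>\<close>)
    have int_\<Theta>: "interior Q \<subseteq> interior \<Theta>" using Q\<Theta> by (rule interior_mono)
    have "Q \<subseteq> {0..} \<times> closure \<Omega>" using Q_sub \<Omega>_cl by fastforce
    then have cont_Q: "continuous_on Q \<psi>" "continuous_on Q \<phi>"
      using continuous_on_subset[OF cont_\<psi>] continuous_on_subset[OF cont_\<phi> Q\<Theta>] by auto
    have int_Q: "(t, x) \<in> interior Q" if "0 < t" "t < T" "d (t, x) < \<rho>" for t x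
    proof -
      define W where "W = {z \<in> {0<..<T} \<times> UNIV. d z \<in> {..<\<rho>}}"
      have "continuous_on ({0<..<T} \<times> UNIV) d"
        using cont_d by (rule continuous_on_subset) auto
      then have "open W"
        using continuous_open_preimage[of "{0<..<T} \<times> UNIV" d "{..<\<rho>}"]
        by (simp add: W_def vimage_def Int_def open_Times)
      then show ?thesis
        by (rule interiorI) (use that in \<open>auto simp: W_def Q_def\<close>)
    qed
    have d_pos: "x \<notin> \<Sigma> t \<longleftrightarrow> 0 < d (t, x)" if "0 \<le> t" for t x
      using infdist_pos_not_in_closed[OF compact_imp_closed[OF \<Sigma>(1)] \<Sigma>(2)] that
      by (auto simp: d_def)
    \<comment> \<open>The lateral rim of the tube. It is compact and \<open>\<phi>\<close> has no
      zero on it, which yields the threshold \<open>\<delta>\<close> demanded by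
      \<open>tube_comparison\<close>.\<close>
    define P where "P = {z \<in> {0..T} \<times> UNIV. d z \<in> {\<rho>}}"
    have "closed P" unfolding P_def by (rule closed_Q) simp
    have "P \<subseteq> Q" by (auto simp: P_def Q_def)
    then have "compact P" using \<open>closed P\<close> \<open>compact Q\<close> compact_Int_closed[of Q P]
      by (simp add: Int_absorb1)
    moreover have "continuous_on P (\<lambda>z. \<bar>\<phi> z\<bar>)"
      using continuous_on_subset[OF cont_Q(2) \<open>P \<subseteq> Q\<close>] by (rule continuous_on_rabs)
    moreover have "0 < \<bar>\<phi> z\<bar>" if "z \<in> P" for z
    proof -
      obtain t x where tx: "z = (t, x)" by fastforce
      have t: "0 \<le> t" "t \<le> T" "d (t, x) = \<rho>" using that by (auto simp: P_def tx)
      have "exp (L\<^sub>v * t) \<le> exp (\<bar>L\<^sub>v\<bar> * T)"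
        using mult_mono[of "L\<^sub>v" "\<bar>L\<^sub>v\<bar>" t T] t by simp
      then have "exp (L\<^sub>v * t) * \<rho> \<le> exp (\<bar>L\<^sub>v\<bar> * T) * (\<epsilon>\<^sub>0 / 2 * exp (- (\<bar>L\<^sub>v\<bar> * T)))"
        using \<rho> by (intro mult_mono) auto
      also have "\<dots> < \<epsilon>\<^sub>0" using eps0(1) by (simp add: exp_minus)
      finally have "exp (L\<^sub>v * t) * infdist x (\<Sigma> t) < \<epsilon>\<^sub>0" using t(3) by (simp add: d_def)
      moreover have "x \<notin> \<Sigma> t" using d_pos[OF t(1)] t(3) \<rho>(1) by simp
      ultimately show ?thesis
        using \<phi>_nonzero[OF t(1)] that \<open>P \<subseteq> Q\<close> Q\<Theta> by (auto simp: tx)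
    qed
    ultimately obtain \<delta> where \<delta>: "0 < \<delta>" "\<And>z. z \<in> P \<Longrightarrow> \<delta> \<le> \<bar>\<phi> z\<bar>"
      using compact_pos_lower_bound by blast
    have inner: "(t, x) \<in> interior Q"
      if "(t, x) \<in> Q" "0 < t" "t < T" "\<bar>\<phi> (t, x)\<bar> < \<delta>" for t x
    proof -
      have "d (t, x) \<noteq> \<rho>" using \<delta>(2)[of "(t, x)"] that by (auto simp: P_def)
      then show ?thesis using int_Q that by (auto simp: Q_def)
    qed
    have pde_Q: "\<exists>q p. GDERIV \<phi> (t, x) :> (q, p) \<and> p \<noteq> 0 \<and> 4 * r\<^sub>0 \<le> (norm p)\<^sup>2 \<and>
        q + w t (x - (\<phi> (t, x) / (norm p)\<^sup>2) *\<^sub>R p) \<bullet> p = 0"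
      if "(t, x) \<in> interior Q" for t x
    proof (rule pde)
      show "(t, x) \<in> interior \<Theta>" "0 < t" using that int_\<Theta> int_U by (auto simp: U_def)
    qed
    have pde_minus: "\<exists>q p. GDERIV (\<lambda>z. - \<phi> z) (t, x) :> (q, p) \<and> p \<noteq> 0 \<and> 4 * r\<^sub>0 \<le> (norm p)\<^sup>2 \<and>
        q + w t (x - (- \<phi> (t, x) / (norm p)\<^sup>2) *\<^sub>R p) \<bullet> p = 0"
      if z: "(t, x) \<in> interior Q" for t x
    proof -
      obtain q p where "GDERIV \<phi> (t, x) :> (q, p)" "p \<noteq> 0" "4 * r\<^sub>0 \<le> (norm p)\<^sup>2"
        "q + w t (x - (\<phi> (t, x) / (norm p)\<^sup>2) *\<^sub>R p) \<bullet> p = 0"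
        using pde_Q[OF z] by blast
      then show ?thesis
        using GDERIV_minus[of \<phi> "(t, x)" "(q, p)"]
        by (intro exI[of _ "- q"] exI[of _ "- p"]) auto
    qed
    have init_eq: "\<psi> (0, x) = \<phi> (0, x)" if "(0, x) \<in> Q" for x
      using psi(1) phi(3) that Q\<Theta> Q_sub unfolding solves_viscosity_problem_def by force
    have C1_Q: "C1_on (interior Q) \<phi>"
      using C1_\<phi> by (rule C1_on_subset) (use Q\<Theta> interior_subset in blast)
    have \<eta>: "\<And>r. 0 \<le> r \<Longrightarrow> 0 \<le> \<eta> r" "\<eta> 0 = 1" "\<And>r. r\<^sub>0 \<le> r \<Longrightarrow> \<eta> r = 0"
      using cut unfolding cutoff_def by (auto simp: image_subset_iff)
    have lip: "norm (w t y - w t y') \<le> L * norm (y - y')" if "0 \<le> t" for t y y'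
      using lipschitz_onD[OF lip_w[OF that], of y y'] by (simp add: dist_norm)
    have Q_UNIV: "Q \<subseteq> {0..T} \<times> UNIV" by (auto simp: Q_def)
    have eq: "\<psi> (t, x) = \<phi> (t, x)"
      if z: "(t, x) \<in> Q" "t < T" "\<bar>\<phi> (t, x)\<bar> * exp (6 * L * t) \<le> \<delta> / 4" for t x
    proof (rule antisym)
      show "\<psi> (t, x) \<le> \<phi> (t, x)"
        by (rule tube_comparison[where w=w and \<eta>=\<eta> and r\<^sub>0=r\<^sub>0 and U=U and Q=Q and T=T and \<delta>=\<delta>,
              OF \<open>0 \<le> L\<close> lip \<eta> \<open>open U\<close> sub \<open>compact Q\<close> Q_UNIV int_U cont_Q \<delta>(1) inner C1_Q pde_Q])
           (use init_eq z in auto)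
      have "- \<psi> (t, x) \<le> - \<phi> (t, x)"
        by (rule tube_comparison[where w=w and \<eta>=\<eta> and r\<^sub>0=r\<^sub>0 and U=U and Q=Q and T=T and \<delta>=\<delta>
              and u="\<lambda>z. - \<psi> z" and \<phi>="\<lambda>z. - \<phi> z",
              OF \<open>0 \<le> L\<close> lip \<eta> \<open>open U\<close> sub_minus \<open>compact Q\<close> Q_UNIV int_U
                continuous_on_minus[OF cont_Q(1)] continuous_on_minus[OF cont_Q(2)] \<delta>(1) _
                C1_on_uminus[OF C1_Q] pde_minus])
           (use init_eq z inner in auto)
      then show "\<phi> (t, x) \<le> \<psi> (t, x)" by simp
    qed
    \<comment> \<open>This set contains all points of the tube where the smallness required by
      \<open>eq\<close> fails. It is compact and misses the surface, where \<open>\<phi>\<close>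
      vanishes, so its distance from the surface turns a bound on \<open>\<phi>\<close> into a
      radius.\<close>
    define B where "B = {z \<in> Q. \<bar>\<phi> z\<bar> * exp (6 * L * fst z) \<in> {\<delta> / 4..}}"
    have "continuous_on Q (\<lambda>z. \<bar>\<phi> z\<bar> * exp (6 * L * fst z))"
      by (intro continuous_intros cont_Q)
    then have "closed B"
      using continuous_closed_preimage[OF _ \<open>closed Q\<close>, of _ "{\<delta> / 4..}"]
      by (simp add: B_def vimage_def Int_def)
    moreover have "B \<subseteq> Q" by (auto simp: B_def)
    ultimately have "compact B" using \<open>compact Q\<close> compact_Int_closed[of Q B]
      by (simp add: Int_absorb1)
    moreover have "continuous_on B d"
      using cont_d by (rule continuous_on_subset) (auto simp: B_def Q_def)
    moreover have "0 < d z" if "z \<in> B" for z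
    proof -
      obtain t x where tx: "z = (t, x)" by fastforce
      have "0 \<le> t" "\<phi> (t, x) \<noteq> 0" using that \<delta>(1) by (auto simp: B_def Q_def tx)
      then show ?thesis using \<phi>_zero d_pos by (auto simp: tx)
    qed
    ultimately obtain \<sigma> where \<sigma>: "0 < \<sigma>" "\<And>z. z \<in> B \<Longrightarrow> \<sigma> \<le> d z"
      using compact_pos_lower_bound by blast
    show ?thesis
    proof (intro bexI[of _ "min \<rho> \<sigma>"] ballI)
      fix t x assume t: "t \<in> {0..T\<^sub>0}" and "x \<in> eps_nbhd (\<Sigma> t) (min \<rho> \<sigma>)"
      then have "d (t, x) < \<rho>" "d (t, x) < \<sigma>"
        using eps_nbhd_iff_infdist[OF \<Sigma>] by (auto simp: d_def)
      then have "(t, x) \<in> Q" "(t, x) \<notin> B" using t T \<sigma>(2)[of "(t, x)"] by (auto simp: Q_def)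
      then show "(t, x) \<in> \<Theta> \<and> \<phi> (t, x) = \<psi> (t, x)"
        using eq[of t x] t T Q\<Theta> by (auto simp: B_def)
    qed (use \<rho> \<sigma> in auto)
  qed

  \<comment> \<open>One nonincreasing radius for all times\<close>
  define R where "R T = {\<rho>\<in>{0<..1}. \<forall>t\<in>{0..T}. \<forall>x\<in>eps_nbhd (\<Sigma> t) \<rho>. (t, x) \<in> \<Theta> \<and> \<phi> (t, x) = \<psi> (t, x)}"
    for T
  have R: "R T \<noteq> {}" "bdd_above (R T)" if "0 \<le> T" for T
    using loc[OF that] by (auto simp: R_def intro: bdd_aboveI[where M=1])
  \<comment> \<open>Radii obtained from \<open>loc\<close> for different times are unrelated. The
    set \<open>R T\<close> shrinks as T grows, so its supremum is nonincreasing; halving it leaves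
    an admissible radius above \<open>e T\<close>.\<close>
  define e where "e T = Sup (R T) / 2" for T
  have e_pos: "0 < e T" if T: "0 \<le> T" for T
  proof -
    obtain \<rho> where "\<rho> \<in> R T" using R(1)[OF T] by blast
    then show ?thesis using cSup_upper[OF _ R(2)[OF T], of \<rho>] by (auto simp: e_def R_def)
  qed
  have e_mono: "antimono_on {0..} e"
  proof (rule monotone_onI)
    fix s t :: real assume "s \<in> {0..}" "t \<in> {0..}" "s \<le> t"
    then show "e t \<le> e s"
      using cSup_subset_mono[OF R(1) R(2), of t s] by (force simp: e_def R_def)
  qed
  have e: "(t, x) \<in> \<Theta>" "\<phi> (t, x) = \<psi> (t, x)" if t: "0 \<le> t" and x: "x \<in> eps_nbhd (\<Sigma> t) (e t)" for t x
  proof -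
    have "e t < Sup (R t)" using e_pos[OF t] by (simp add: e_def)
    then obtain \<rho> where \<rho>: "\<rho> \<in> R t" "e t < \<rho>" using less_cSup_iff[OF R[OF t]] by blast
    then have "x \<in> eps_nbhd (\<Sigma> t) \<rho>" using x by (force simp: eps_nbhd_def)
    then show "(t, x) \<in> \<Theta>" "\<phi> (t, x) = \<psi> (t, x)" using \<rho>(1) t by (auto simp: R_def)
  qed
  define \<Theta>' where "\<Theta>' = (SIGMA t:{0..}. eps_nbhd (\<Sigma> t) (e t))"
  have "tubular_nbhd \<Omega> \<Sigma> \<Theta>'"
    unfolding tubular_nbhd_def
  proof (intro conjI allI impI exI[of _ e])
    show "\<Theta>' \<subseteq> {0..} \<times> \<Omega>" using e(1) \<Theta>_\<Omega> by (auto simp: \<Theta>'_def)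
    show "(\<Union>t\<in>{0..}. {t} \<times> \<Sigma> t) \<subseteq> \<Theta>'" using e_pos by (force simp: \<Theta>'_def eps_nbhd_def)
    fix t :: real assume t: "0 \<le> t"
    have "{x \<in> \<Omega>. (t, x) \<in> \<Theta>'} = eps_nbhd (\<Sigma> t) (e t)"
      using t e(1) \<Theta>_\<Omega> by (auto simp: \<Theta>'_def)
    then show "open {x \<in> \<Omega>. (t, x) \<in> \<Theta>'}" by (simp add: eps_nbhd_def open_UN)
    show "{t} \<times> eps_nbhd (\<Sigma> t) (e t) \<subseteq> \<Theta>'" using t by (auto simp: \<Theta>'_def)
  qed (use e_pos e_mono in auto)
  moreover have "\<Theta>' \<subseteq> \<Theta>" "\<forall>z\<in>\<Theta>'. \<phi> z = \<psi> z" using e by (auto simp: \<Theta>'_def)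
  ultimately show ?thesis by blast
qed

end
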